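(* Suppose that the random measure $G$ satisfies the Ghirlanda-Guerra identities. Let $n\geq 1$, let $f_1,\ldots,f_n:\mathbb{R}^{n(n-1)/2}\times\mathbb{R}\to\mathbb{R}$ be bounded measurable functions, let $F$ and $F_1,\ldots,F_n$ be defined from them as in the context, and let $\Phi$ be a bounded measurable function of $R^n$ (when $n=1$, $\Phi$ is a constant). Then $$ \mathbb{E}\langle\Phi\rangle = \mathbb{E}\Bigl\langle \frac{\Phi \exp \sum_{l=1}^{n} F_l(\sigma^l,\sigma^1,\ldots,\sigma^n)} {\langle\exp F(\sigma,\sigma^1,\ldots,\sigma^n)\rangle_{-}^n} \Bigr\rangle, $$ where $\langle\cdot\rangle_{-}$ in the denominator denotes the average with respect to $G$ in $\sigma$ only, for fixed $\sigma^1,\ldots,\sigma^n$, and the outside average $\langle\cdot\rangle$ of the ratio is in $\sigma^1,\ldots,\sigma^n$.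
   Context: $G$ is a random probability measure on the unit ball of a separable Hilbert space $H$; $(\sigma^l)_{l\geq 1}$ is an i.i.d. sequence from $G$; $\langle\cdot\rangle$ is the average with respect to $G^{\otimes\infty}$; $\mathbb{E}$ is the expectation with respect to the randomness of $G$. $R_{l,l'}=\sigma^l\cdot\sigma^{l'}$ is the scalar product (overlap), $R^n=(R_{l,l'})_{l<l'\leq n}$, and $\mu$ is the law of $R_{1,2}$ under $\mathbb{E}G^{\otimes 2}$. Ghirlanda-Guerra identities: for any $n\geq 2$, any bounded measurable function $f$ of the overlaps $(R_{l,l'})_{l,l'\leq n}$ and any bounded measurable function $\psi$ of one overlap, $$\mathbb{E}\langle f\psi(R_{1,n+1})\rangle=\frac1n\,\mathbb{E}\langle f\rangle\,\mathbb{E}\langle\psi(R_{1,2})\rangle+\frac1n\sum_{l=2}^n\mathbb{E}\langle f\psi(R_{1,l})\rangle .$$ Definition of $F$ and $F_l$: $$F(\sigma,\sigma^1,\ldots,\sigma^n)=f_1(R^n,\sigma\cdot\sigma^1)+\ldots+f_n(R^n,\sigma\cdot\sigma^n),$$ and for $1\leq l\leq n$, $$F_l(\sigma,\sigma^1,\ldots,\sigma^n)=F(\sigma,\sigma^1,\ldots,\sigma^n)-f_l(R^n,\sigma\cdot\sigma^l)+\int f_l(R^n,x)\,d\mu(x).$$ *)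

theory Defs
  imports "HOL-Probability.Probability"
begin

text \<open>A random probability measure is a kernel \<open>G\<close> from a probability space \<open>M\<close> to the space
  of Borel probability measures on the Hilbert space.\<close>

definition random_measure_on_unit_ball ::
  "'w measure \<Rightarrow> ('w \<Rightarrow> 'h::{real_inner, polish_space} measure) \<Rightarrow> bool" where
  "random_measure_on_unit_ball M G \<longleftrightarrow>
     prob_space M \<and> G \<in> M \<rightarrow>\<^sub>M prob_algebra borel \<and>
     (AE \<omega> in M. measure (G \<omega>) (cball 0 1) = 1)"

text \<open>Replicas are numbered from 1: a configuration is a sequence \<open>\<sigma>\<close> of which only the values
  at \<open>l \<ge> 1\<close> are used.\<close>

definition replica_average :: "'h measure \<Rightarrow> ((nat \<Rightarrow> 'h) \<Rightarrow> real) \<Rightarrow> real" where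
  "replica_average g h = (\<integral>\<sigma>. h \<sigma> \<partial>(\<Pi>\<^sub>M l\<in>{1..}. g))"

definition overlap :: "(nat \<Rightarrow> 'h::real_inner) \<Rightarrow> nat \<Rightarrow> nat \<Rightarrow> real" where
  "overlap \<sigma> l l' = \<sigma> l \<bullet> \<sigma> l'"

text \<open>Arrays of reals indexed by a finite set of pairs \<open>I\<close> are the elements of
  \<open>\<Pi>\<^sub>M p\<in>I. borel\<close>. For \<open>I = offdiag n\<close> this is a copy of the space of dimension
  \<open>n (n - 1) / 2\<close>, a single point if \<open>n = 1\<close>.\<close>

definition offdiag :: "nat \<Rightarrow> (nat \<times> nat) set" where
  "offdiag n = {(l, l'). 1 \<le> l \<and> l < l' \<and> l' \<le> n}"

abbreviation array_space :: "(nat \<times> nat) set \<Rightarrow> (nat \<times> nat \<Rightarrow> real) measure" where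
  "array_space I \<equiv> (\<Pi>\<^sub>M p\<in>I. borel)"

definition overlap_array ::
  "(nat \<times> nat) set \<Rightarrow> (nat \<Rightarrow> 'h::real_inner) \<Rightarrow> nat \<times> nat \<Rightarrow> real" where
  "overlap_array I \<sigma> = (\<lambda>(l, l')\<in>I. overlap \<sigma> l l')"

definition overlaps :: "nat \<Rightarrow> (nat \<Rightarrow> 'h::real_inner) \<Rightarrow> nat \<times> nat \<Rightarrow> real" where
  "overlaps n = overlap_array (offdiag n)"

definition bounded_measurable :: "'a measure \<Rightarrow> ('a \<Rightarrow> real) \<Rightarrow> bool" where
  "bounded_measurable N f \<longleftrightarrow> f \<in> borel_measurable N \<and> bounded (f ` space N)"

definition overlap_law ::
  "'w measure \<Rightarrow> ('w \<Rightarrow> 'h::{real_inner, polish_space} measure) \<Rightarrow> real measure" where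
  "overlap_law M G = distr (M \<bind> (\<lambda>\<omega>. G \<omega> \<Otimes>\<^sub>M G \<omega>)) borel (\<lambda>(x, y). x \<bullet> y)"

text \<open>In the identities, \<open>f\<close> may also depend on the self-overlaps.\<close>

definition ghirlanda_guerra ::
  "'w measure \<Rightarrow> ('w \<Rightarrow> 'h::{real_inner, polish_space} measure) \<Rightarrow> bool" where
  "ghirlanda_guerra M G \<longleftrightarrow>
     (\<forall>n\<ge>2. \<forall>f \<psi>.
        bounded_measurable (array_space ({1..n} \<times> {1..n})) f \<longrightarrow> bounded_measurable borel \<psi> \<longrightarrow>
        (\<integral>\<omega>. replica_average (G \<omega>)
               (\<lambda>\<sigma>. f (overlap_array ({1..n} \<times> {1..n}) \<sigma>) * \<psi> (overlap \<sigma> 1 (n + 1))) \<partial>M) =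
        1 / real n
          * (\<integral>\<omega>. replica_average (G \<omega>) (\<lambda>\<sigma>. f (overlap_array ({1..n} \<times> {1..n}) \<sigma>)) \<partial>M)
          * (\<integral>\<omega>. replica_average (G \<omega>) (\<lambda>\<sigma>. \<psi> (overlap \<sigma> 1 2)) \<partial>M)
        + 1 / real n
          * (\<Sum>l = 2..n. \<integral>\<omega>. replica_average (G \<omega>)
               (\<lambda>\<sigma>. f (overlap_array ({1..n} \<times> {1..n}) \<sigma>) * \<psi> (overlap \<sigma> 1 l)) \<partial>M))"

definition F_total ::
  "nat \<Rightarrow> (nat \<Rightarrow> (nat \<times> nat \<Rightarrow> real) \<times> real \<Rightarrow> real) \<Rightarrow> 'h::real_inner \<Rightarrow> (nat \<Rightarrow> 'h) \<Rightarrow> real" where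
  "F_total n f s \<sigma> = (\<Sum>j = 1..n. f j (overlaps n \<sigma>, s \<bullet> \<sigma> j))"

definition F_part ::
  "real measure \<Rightarrow> nat \<Rightarrow> (nat \<Rightarrow> (nat \<times> nat \<Rightarrow> real) \<times> real \<Rightarrow> real) \<Rightarrow> nat
     \<Rightarrow> 'h::real_inner \<Rightarrow> (nat \<Rightarrow> 'h) \<Rightarrow> real" where
  "F_part \<mu> n f l s \<sigma> =
     F_total n f s \<sigma> - f l (overlaps n \<sigma>, s \<bullet> \<sigma> l) + (\<integral>x. f l (overlaps n \<sigma>, x) \<partial>\<mu>)"

end

theory Submission
  imports Defs
begin

text \<open>
  Write \<open>m = n + k\<close>, let \<open>F\<^sup>(\<^sup>l\<^sup>)\<close> be \<open>F\<^sub>l(\<sigma>\<^sup>l, \<sigma>\<^sup>1, \<dots>, \<sigma>\<^sup>n)\<close> for \<open>l \<le> n\<close> and \<open>F(\<sigma>\<^sup>l, \<sigma>\<^sup>1, \<dots>, \<sigma>\<^sup>n)\<close> for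
  \<open>l > n\<close>, put \<open>D\<^sub>m = F\<^sup>(\<^sup>1\<^sup>) + \<dots> + F\<^sup>(\<^sup>m\<^sup>)\<close> and \<open>Z(t) = \<langle>exp (t F(\<sigma>))\<rangle>\<close>, the average being over \<open>\<sigma>\<close>
  only, and consider
    \<open>\<phi>\<^sub>k(t) = E \<langle>A\<^sub>k exp (t D\<^sub>m) / Z(t)\<^sup>m\<rangle>\<close>  with  \<open>A\<^sub>0 = \<Phi>\<close>,  \<open>A\<^sub>k\<^sub>+\<^sub>1 = A\<^sub>k (D\<^sub>m - m F\<^sup>(\<^sup>m\<^sup>+\<^sup>1\<^sup>))\<close>.
  The theorem says that \<open>\<phi>\<^sub>0(0) = \<phi>\<^sub>0(1)\<close>. It follows from three facts.

  \<^item> \<open>\<phi>\<^sub>k' = \<phi>\<^sub>k\<^sub>+\<^sub>1\<close> (\<open>tilted_has_derivative\<close>). Differentiation produces the factor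
    \<open>D\<^sub>m - m Z'(t) / Z(t)\<close>, and the average over \<open>\<sigma>\<close> that defines \<open>Z'\<close> is replaced by a fresh
    replica \<open>\<sigma>\<^sup>m\<^sup>+\<^sup>1\<close>.

  \<^item> \<open>\<phi>\<^sub>k\<^sub>+\<^sub>1(0) = 0\<close> (\<open>tilted_Suc_0\<close>). As \<open>Z(0) = 1\<close> and \<open>A\<^sub>k\<close> is a function of the overlaps of \<open>m\<close>
    replicas, this is \<open>E \<langle>A\<^sub>k D\<^sub>m\<rangle> = m E \<langle>A\<^sub>k F\<^sup>(\<^sup>m\<^sup>+\<^sup>1\<^sup>)\<rangle>\<close>. The latter is the sum over \<open>j \<le> n\<close> of the
    Ghirlanda-Guerra identities for the overlaps \<open>R\<^sub>j\<^sub>,\<^sub>m\<^sub>+\<^sub>1\<close> of the new replica: the term with the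
    independent copy of the overlap is exactly what distinguishes \<open>F\<^sub>j\<close> from \<open>F\<close>.

  \<^item> \<open>\<bar>\<phi>\<^sub>k(t)\<bar> \<le> c K\<^sup>k k!\<close> on \<open>[0, 1]\<close> (\<open>tilted_bound\<close>), since the \<open>k\<close>-th factor of \<open>A\<^sub>k\<close> is bounded by
    a multiple of \<open>k\<close>.

  So \<open>\<phi>\<^sub>0\<close> is real analytic on \<open>[0, 1]\<close> and all its derivatives vanish at \<open>0\<close>: it is constant
  (\<open>constant_if_derivatives_vanish_at_0\<close>).

  The identities are needed for \<open>f\<close> and \<open>\<psi>\<close> combined in one function of the array and of the new
  overlap, not only for products. They extend because both sides are probability measures that
  agree on rectangles (\<open>ghirlanda_guerra_array_1\<close>).
\<close>

section \<open>Two facts of real analysis\<close>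

text \<open>The bound makes the Taylor series at any point converge to the function on an interval of
  length \<open>1 / (4 K)\<close>, so the vanishing of the derivatives propagates from \<open>0\<close> to \<open>1\<close> in steps
  of that length.\<close>

lemma constant_if_derivatives_vanish_at_0:
  fixes g :: "nat \<Rightarrow> real \<Rightarrow> real"
  assumes deriv: "\<And>k t. (g k has_real_derivative g (Suc k) t) (at t)"
    and bound: "\<And>k t. 0 \<le> t \<Longrightarrow> t \<le> 1 \<Longrightarrow> \<bar>g k t\<bar> \<le> C * K ^ k * fact k"
    and zero: "\<And>k. g (Suc k) 0 = 0"
    and K: "K > 0"
  shows "g 0 1 = g 0 0"
proof -
  have C: "C \<ge> 0"
    using bound[of 0 0] by simp
  have step: "g k t = g k c"
    if c: "0 \<le> c" "c \<le> t" "t \<le> 1" "t \<le> c + 1 / (4 * K)" and z: "\<And>k. g (Suc k) c = 0" for k c t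
  proof (cases "c = t")
    case False
    have le: "\<bar>g k t - g k c\<bar> \<le> C * K ^ k * fact k * 2 ^ k * (1 / 2) ^ N" if N: "N > 0" for N
    proof -
      have "\<exists>s. c < s \<and> s < t \<and> g k t = (\<Sum>m<N. g (k + m) c / fact m * (t - c) ^ m)
          + g (k + N) s / fact N * (t - c) ^ N"
        using Taylor_up[of N "\<lambda>m. g (k + m)" "g k" c t c] N deriv False c by auto
      then obtain s where s: "c < s" "s < t" and eq: "g k t = (\<Sum>m<N. g (k + m) c / fact m * (t - c) ^ m)
          + g (k + N) s / fact N * (t - c) ^ N"
        by blast
      have "(\<Sum>m<N. g (k + m) c / fact m * (t - c) ^ m) = (\<Sum>m<N. if m = 0 then g k c else 0)"
      proof (rule sum.cong)
        fix m show "g (k + m) c / fact m * (t - c) ^ m = (if m = 0 then g k c else 0)"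
          by (cases m) (auto simp: z)
      qed simp
      also have "\<dots> = g k c"
        using N by simp
      finally have "g k t - g k c = g (k + N) s / fact N * (t - c) ^ N"
        using eq by simp
      then have "\<bar>g k t - g k c\<bar> = \<bar>g (k + N) s\<bar> / fact N * (t - c) ^ N"
        using c by (simp add: abs_mult)
      also have "\<dots> \<le> (C * K ^ (k + N) * fact (k + N)) / fact N * (1 / (4 * K)) ^ N"
        using c s by (intro mult_mono divide_right_mono bound power_mono) (use C K in auto)
      also have "fact (k + N) = (fact k * fact N * real ((k + N) choose N))"
        using binomial_fact_lemma[of N "k + N", THEN arg_cong[where f = real]]
        by (simp add: ac_simps)
      also have "C * K ^ (k + N) * (fact k * fact N * real ((k + N) choose N)) / fact N * (1 / (4 * K)) ^ N
          = C * K ^ k * fact k * (1 / 4) ^ N * real ((k + N) choose N)"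
        using K by (simp add: power_add power_mult_distrib field_simps)
      \<comment> \<open>The binomial coefficient is at most \<open>2\<^sup>k\<^sup>+\<^sup>N\<close>; the step \<open>1 / (4 K)\<close> leaves room for it.\<close>
      also have "\<dots> \<le> C * K ^ k * fact k * (1 / 4) ^ N * 2 ^ (k + N)"
      proof (intro mult_left_mono)
        have "(k + N) choose N \<le> 2 ^ (k + N)"
          using binomial_le_pow2 by blast
        then show "real ((k + N) choose N) \<le> 2 ^ (k + N)"
          by (metis of_nat_le_iff of_nat_numeral of_nat_power)
      qed (use C K in auto)
      also have "\<dots> = C * K ^ k * fact k * 2 ^ k * ((1 / 4) ^ N * 2 ^ N)"
        by (simp add: power_add)
      also have "(1 / 4 :: real) ^ N * 2 ^ N = (1 / 2) ^ N"
        by (simp flip: power_mult_distrib)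
      finally show ?thesis .
    qed
    have "(\<lambda>N. C * K ^ k * fact k * 2 ^ k * (1 / 2) ^ N) \<longlonglongrightarrow> C * K ^ k * fact k * 2 ^ k * 0"
      by (intro tendsto_intros) auto
    then have "\<bar>g k t - g k c\<bar> \<le> 0"
      by (intro LIMSEQ_le_const[where X = "\<lambda>N. C * K ^ k * fact k * 2 ^ k * (1 / 2) ^ N"])
        (auto intro!: exI[of _ 1] le)
    then show ?thesis by simp
  qed simp
  have reach: "\<forall>k. \<forall>t\<in>{0..1}. t \<le> real i * (1 / (4 * K)) \<longrightarrow> g k t = g k 0" for i
  proof (induction i)
    case (Suc i)
    show ?case
    proof (intro allI ballI impI)
      fix k t assume t: "t \<in> {0..1::real}" "t \<le> real (Suc i) * (1 / (4 * K))"
      define c where "c = max 0 (t - 1 / (4 * K))"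
      have c: "0 \<le> c" "c \<le> t" "t \<le> c + 1 / (4 * K)" "c \<le> real i * (1 / (4 * K))"
        using t K by (auto simp: c_def algebra_simps add_divide_distrib)
      have eq: "g k c = g k 0" for k
        using Suc.IH c t(1) by (meson atLeastAtMost_iff order.trans)
      have "g k t = g k c"
        by (rule step) (use c t(1) eq zero in \<open>simp_all only: atLeastAtMost_iff\<close>)
      then show "g k t = g k 0"
        using eq by simp
    qed
  qed auto
  obtain i :: nat where "4 * K \<le> real i"
    using real_arch_simple by blast
  then have i: "1 \<le> real i * (1 / (4 * K))"
    using K by simp
  show ?thesis
    by (rule reach[of i, rule_format]) (use i in simp_all)
qed

text \<open>Differentiation under the integral sign, for a derivative that is bounded near the point.\<close>

lemma has_real_derivative_integral:
  fixes h h' :: "'a \<Rightarrow> real \<Rightarrow> real"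
  assumes "finite_measure N"
    and t: "t \<in> {a<..<b}"
    and deriv: "\<And>x s. x \<in> space N \<Longrightarrow> s \<in> {a<..<b} \<Longrightarrow> (h x has_real_derivative h' x s) (at s)"
    and bound: "\<And>x s. x \<in> space N \<Longrightarrow> s \<in> {a<..<b} \<Longrightarrow> \<bar>h' x s\<bar> \<le> B"
    and int: "\<And>s. s \<in> {a<..<b} \<Longrightarrow> integrable N (\<lambda>x. h x s)"
    and meas: "(\<lambda>x. h' x t) \<in> borel_measurable N"
  shows "((\<lambda>s. \<integral>x. h x s \<partial>N) has_real_derivative (\<integral>x. h' x t \<partial>N)) (at t)"
proof -
  interpret finite_measure N by fact
  have "((\<lambda>s. ((\<integral>x. h x s \<partial>N) - (\<integral>x. h x t \<partial>N)) / (s - t)) \<longlongrightarrow> (\<integral>x. h' x t \<partial>N)) (at t within {a<..<b})"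
    unfolding tendsto_at_iff_sequentially comp_def
  proof (intro allI impI)
    fix X :: "nat \<Rightarrow> real" assume X: "\<forall>i. X i \<in> {a<..<b} - {t}" "X \<longlonglongrightarrow> t"
    have "(\<lambda>i. \<integral>x. (h x (X i) - h x t) / (X i - t) \<partial>N) \<longlonglongrightarrow> (\<integral>x. h' x t \<partial>N)"
    proof (rule integral_dominated_convergence[where w = "\<lambda>_. B"])
      show "(\<lambda>x. (h x (X i) - h x t) / (X i - t)) \<in> borel_measurable N" for i
        using int[of "X i"] int[of t] X(1) t by (intro borel_measurable_divide borel_measurable_diff) auto
      show "AE x in N. (\<lambda>i. (h x (X i) - h x t) / (X i - t)) \<longlonglongrightarrow> h' x t"
      proof (rule AE_I2)
        fix x assume x: "x \<in> space N"
        have "((\<lambda>s. (h x s - h x t) / (s - t)) \<longlongrightarrow> h' x t) (at t)"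
          using deriv[OF x t] by (simp add: has_field_derivative_iff)
        moreover have "filterlim X (at t) sequentially"
          using X by (auto simp: filterlim_at)
        ultimately show "(\<lambda>i. (h x (X i) - h x t) / (X i - t)) \<longlonglongrightarrow> h' x t"
          by (rule filterlim_compose)
      qed
      show "AE x in N. norm ((h x (X i) - h x t) / (X i - t)) \<le> B" for i
      proof (rule AE_I2)
        fix x assume x: "x \<in> space N"
        have Xi: "X i \<in> {a<..<b}" "X i \<noteq> t" using X by auto
        have "norm (h x (X i) - h x t) \<le> B * norm (X i - t)"
        proof (rule field_differentiable_bound[of "{a<..<b}" "h x" "h' x"])
          show "(h x has_real_derivative h' x s) (at s within {a<..<b})" if "s \<in> {a<..<b}" for s
            using deriv[OF x that] by (rule has_field_derivative_at_within)
          show "norm (h' x s) \<le> B" if "s \<in> {a<..<b}" for s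
            using bound[OF x that] by simp
        qed (use Xi t in auto)
        then show "norm ((h x (X i) - h x t) / (X i - t)) \<le> B"
          using Xi by (simp add: divide_simps)
      qed
    qed (use meas in auto)
    moreover have "(\<integral>x. (h x (X i) - h x t) / (X i - t) \<partial>N) = ((\<integral>x. h x (X i) \<partial>N) - (\<integral>x. h x t \<partial>N)) / (X i - t)" for i
      using int[of "X i"] int[of t] X(1) t by (subst integral_divide_zero) (auto intro!: Bochner_Integration.integral_diff)
    ultimately show "(\<lambda>i. ((\<integral>x. h x (X i) \<partial>N) - (\<integral>x. h x t \<partial>N)) / (X i - t)) \<longlonglongrightarrow> (\<integral>x. h' x t \<partial>N)"
      by (simp only:)
  qed
  then show ?thesis
    using t at_within_open[of t "{a<..<b}"] by (simp add: has_field_derivative_iff)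
qed

section \<open>Infinite products of a kernel\<close>

lemma measurable_PiM_kernel:
  assumes G: "G \<in> M \<rightarrow>\<^sub>M prob_algebra N"
  shows "(\<lambda>\<omega>. \<Pi>\<^sub>M i\<in>I. G \<omega>) \<in> M \<rightarrow>\<^sub>M prob_algebra (\<Pi>\<^sub>M i\<in>I. N)"
proof -
  have G_sp: "prob_space (G \<omega>)" "sets (G \<omega>) = sets N" if "\<omega> \<in> space M" for \<omega>
    using measurable_space[OF G that] by (auto simp: space_prob_algebra)
  show ?thesis
  proof (rule measurable_prob_algebra_generated[OF sets_PiM Int_stable_prod_algebra prod_algebra_sets_into_space])
    fix \<omega> assume \<omega>: "\<omega> \<in> space M"
    show "prob_space (\<Pi>\<^sub>M i\<in>I. G \<omega>)"
      using G_sp[OF \<omega>] by (intro prob_space_PiM)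
    show "sets (\<Pi>\<^sub>M i\<in>I. G \<omega>) = sets (\<Pi>\<^sub>M i\<in>I. N)"
      using G_sp[OF \<omega>] by (intro sets_PiM_cong) auto
  next
    fix A assume "A \<in> prod_algebra I (\<lambda>i. N)"
    then obtain J E where A: "A = prod_emb I (\<lambda>i. N) J (\<Pi>\<^sub>E j\<in>J. E j)" "finite J" "J \<subseteq> I"
      and E: "\<And>i. i \<in> J \<Longrightarrow> E i \<in> sets N"
      by (auto elim!: prod_algebraE)
    have "emeasure (\<Pi>\<^sub>M i\<in>I. G \<omega>) A = (\<Prod>j\<in>J. emeasure (G \<omega>) (E j))" if \<omega>: "\<omega> \<in> space M" for \<omega>
    proof -
      have "A = prod_emb I (\<lambda>i. G \<omega>) J (\<Pi>\<^sub>E j\<in>J. E j)"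
        using sets_eq_imp_space_eq[OF G_sp(2)[OF \<omega>]] by (simp add: A prod_emb_def)
      then show ?thesis
        using A E G_sp[OF \<omega>] by (auto intro!: emeasure_PiM_emb)
    qed
    moreover have "(\<lambda>\<omega>. \<Prod>j\<in>J. emeasure (G \<omega>) (E j)) \<in> borel_measurable M"
      using E by (intro borel_measurable_prod_ennreal
          measurable_compose[OF measurable_prob_algebraD[OF G] measurable_emeasure_subprob_algebra])
    ultimately show "(\<lambda>\<omega>. emeasure (\<Pi>\<^sub>M i\<in>I. G \<omega>) A) \<in> borel_measurable M"
      by (simp cong: measurable_cong)
  qed
qed

text \<open>If \<open>H\<close> does not depend on the component \<open>k\<close> of its first argument, then that component can
  play the part of an independent sample from \<open>g\<close>.\<close>

lemma integral_PiM_fresh_component: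
  fixes H :: "(nat \<Rightarrow> 'a) \<times> 'a \<Rightarrow> real"
  assumes "prob_space g" and k: "k \<in> I"
    and H[measurable]: "H \<in> borel_measurable ((\<Pi>\<^sub>M i\<in>I. g) \<Otimes>\<^sub>M g)"
    and bound: "\<And>z. z \<in> space ((\<Pi>\<^sub>M i\<in>I. g) \<Otimes>\<^sub>M g) \<Longrightarrow> \<bar>H z\<bar> \<le> B"
    and free: "\<And>\<sigma> s s'. H (\<sigma>(k := s), s') = H (\<sigma>, s')"
  shows "(\<integral>\<sigma>. (\<integral>s. H (\<sigma>, s) \<partial>g) \<partial>(\<Pi>\<^sub>M i\<in>I. g)) = (\<integral>\<sigma>. H (\<sigma>, \<sigma> k) \<partial>(\<Pi>\<^sub>M i\<in>I. g))"
proof -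
  interpret g: prob_space g by fact
  let ?P = "\<Pi>\<^sub>M i\<in>I. g" and ?Q = "\<Pi>\<^sub>M i\<in>I - {k}. g"
  interpret Q: prob_space ?Q by (intro prob_space_PiM g.prob_space_axioms)
  interpret P: prob_space ?P by (intro prob_space_PiM g.prob_space_axioms)
  interpret gQ: pair_prob_space g ?Q ..
  have I: "insert k (I - {k}) = I" using k by auto
  have upd[measurable]: "(\<lambda>(x, X). X(k := x)) \<in> g \<Otimes>\<^sub>M ?Q \<rightarrow>\<^sub>M ?P"
    unfolding case_prod_beta' by (rule measurable_fun_upd[where J = "I - {k}"]) (use k in auto)
  have P_eq: "distr (g \<Otimes>\<^sub>M ?Q) ?P (\<lambda>(x, X). X(k := x)) = ?P"
    using distr_pair_PiM_eq_PiM[of "I - {k}" "\<lambda>_. g" k] g.prob_space_axioms unfolding I by simp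
  have int_P: "(\<integral>\<sigma>. u \<sigma> \<partial>?P) = (\<integral>X. (\<integral>x. u (X(k := x)) \<partial>g) \<partial>?Q)"
    if [measurable]: "u \<in> borel_measurable ?P" and b: "\<And>\<sigma>. \<sigma> \<in> space ?P \<Longrightarrow> \<bar>u \<sigma>\<bar> \<le> B'" for u :: "(nat \<Rightarrow> 'a) \<Rightarrow> real" and B'
  proof -
    have "(\<integral>\<sigma>. u \<sigma> \<partial>?P) = (\<integral>z. u (case z of (x, X) \<Rightarrow> X(k := x)) \<partial>(g \<Otimes>\<^sub>M ?Q))"
      by (subst (1) P_eq[symmetric]) (rule integral_distr; measurable)
    also have "\<dots> = (\<integral>(x, X). u (X(k := x)) \<partial>(g \<Otimes>\<^sub>M ?Q))"
      by (simp add: case_prod_beta')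
    also have "\<dots> = (\<integral>X. (\<integral>x. u (X(k := x)) \<partial>g) \<partial>?Q)"
    proof (rule gQ.integral_snd[symmetric])
      have "(\<lambda>z. u (case z of (x, X) \<Rightarrow> X(k := x))) \<in> borel_measurable (g \<Otimes>\<^sub>M ?Q)"
        by measurable
      then have "(\<lambda>(x, X). u (X(k := x))) \<in> borel_measurable (g \<Otimes>\<^sub>M ?Q)"
        by (simp add: case_prod_beta')
      then show "integrable (g \<Otimes>\<^sub>M ?Q) (\<lambda>(x, X). u (X(k := x)))"
        by (rule gQ.P.integrable_const_bound[where B = B', rotated])
          (use b measurable_space[OF upd] in \<open>force intro!: AE_I2\<close>)
    qed
    finally show ?thesis .
  qed
  \<comment> \<open>Both sides are equal to the integral over the other components and one sample \<open>x\<close>.\<close>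
  have "(\<integral>\<sigma>. H (\<sigma>, \<sigma> k) \<partial>?P) = (\<integral>X. (\<integral>x. H (X(k := x), x) \<partial>g) \<partial>?Q)"
  proof (subst int_P[of "\<lambda>\<sigma>. H (\<sigma>, \<sigma> k)" B])
    have [measurable]: "(\<lambda>\<sigma>. \<sigma> k) \<in> ?P \<rightarrow>\<^sub>M g"
      using k by (rule measurable_component_singleton)
    show "(\<lambda>\<sigma>. H (\<sigma>, \<sigma> k)) \<in> borel_measurable ?P" by measurable
    show "\<bar>H (\<sigma>, \<sigma> k)\<bar> \<le> B" if "\<sigma> \<in> space ?P" for \<sigma>
      using that k by (intro bound) (auto simp: space_pair_measure space_PiM)
  qed simp
  also have "\<dots> = (\<integral>X. (\<integral>y. (\<integral>s. H (X(k := y), s) \<partial>g) \<partial>g) \<partial>?Q)"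
    by (simp add: free g.prob_space)
  also have "\<dots> = (\<integral>\<sigma>. (\<integral>s. H (\<sigma>, s) \<partial>g) \<partial>?P)"
  proof (rule int_P[symmetric, of "\<lambda>\<sigma>. \<integral>s. H (\<sigma>, s) \<partial>g" B])
    show "(\<lambda>\<sigma>. \<integral>s. H (\<sigma>, s) \<partial>g) \<in> borel_measurable ?P" by measurable
    fix \<sigma> assume \<sigma>: "\<sigma> \<in> space ?P"
    have "\<bar>\<integral>s. H (\<sigma>, s) \<partial>g\<bar> \<le> (\<integral>s. \<bar>H (\<sigma>, s)\<bar> \<partial>g)"
      by (rule integral_abs_bound)
    also have "\<dots> \<le> B"
      using \<sigma> by (intro g.integral_le_const integrable_abs g.integrable_const_bound[where B = B] AE_I2 measurable_Pair2[OF H])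
        (auto intro!: bound simp: space_pair_measure)
    finally show "\<bar>\<integral>s. H (\<sigma>, s) \<partial>g\<bar> \<le> B" .
  qed
  finally show ?thesis by simp
qed

section \<open>The joint law of the random measure and its replicas\<close>

text \<open>Replicas are numbered from \<open>1\<close>; the simplifier must leave this number alone.\<close>

declare One_nat_def [simp del]

text \<open>A random probability measure \<open>G\<close> on a probability space \<open>M\<close>.\<close>

locale random_measure =
  fixes M :: "'w measure" and G :: "'w \<Rightarrow> 'h::{real_inner, polish_space} measure"
  assumes random_measure: "random_measure_on_unit_ball M G"
begin

lemma G_measurable: "G \<in> M \<rightarrow>\<^sub>M prob_algebra borel"
  using random_measure by (simp add: random_measure_on_unit_ball_def)

lemma G_measurable_subprob[measurable]: "G \<in> M \<rightarrow>\<^sub>M subprob_algebra borel"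
  using G_measurable by (rule measurable_prob_algebraD)

sublocale M: prob_space M
  using random_measure by (simp add: random_measure_on_unit_ball_def)

lemma prob_space_G: "\<omega> \<in> space M \<Longrightarrow> prob_space (G \<omega>)"
  and sets_G: "\<omega> \<in> space M \<Longrightarrow> sets (G \<omega>) = sets borel"
  using measurable_space[OF G_measurable] by (auto simp: space_prob_algebra)

abbreviation replica_space :: "(nat \<Rightarrow> 'h) measure" where
  "replica_space \<equiv> \<Pi>\<^sub>M l\<in>{1..}. borel"

text \<open>The law of the sequence of replicas, an i.i.d. sequence from \<open>G \<omega>\<close>.\<close>

definition replicas :: "'w \<Rightarrow> (nat \<Rightarrow> 'h) measure" where
  "replicas \<omega> = (\<Pi>\<^sub>M l\<in>{1..}. G \<omega>)"

lemma replicas_measurable: "replicas \<in> M \<rightarrow>\<^sub>M prob_algebra replica_space"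
  unfolding replicas_def using measurable_PiM_kernel[OF G_measurable] .

lemma prob_space_replicas: "\<omega> \<in> space M \<Longrightarrow> prob_space (replicas \<omega>)"
  and sets_replicas: "\<omega> \<in> space M \<Longrightarrow> sets (replicas \<omega>) = sets replica_space"
  using measurable_space[OF replicas_measurable] by (auto simp: space_prob_algebra)

lemma replica_average_eq: "replica_average (G \<omega>) h = (\<integral>\<sigma>. h \<sigma> \<partial>replicas \<omega>)"
  by (simp add: replica_average_def replicas_def)

text \<open>The law of the pair formed by the randomness of \<open>G\<close> and the sequence of replicas. An integral
  with respect to it is the average \<open>E \<langle>\<cdot>\<rangle>\<close>.\<close>

definition joint :: "('w \<times> (nat \<Rightarrow> 'h)) measure" where
  "joint = M \<bind> (\<lambda>\<omega>. distr (replicas \<omega>) (M \<Otimes>\<^sub>M replica_space) (Pair \<omega>))"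

lemma joint_kernel:
  "(\<lambda>\<omega>. distr (replicas \<omega>) (M \<Otimes>\<^sub>M replica_space) (Pair \<omega>)) \<in> M \<rightarrow>\<^sub>M prob_algebra (M \<Otimes>\<^sub>M replica_space)"
  by (rule measurable_distr_prob_space2[OF replicas_measurable]) simp

lemma sets_joint[simp, measurable_cong]: "sets joint = sets (M \<Otimes>\<^sub>M replica_space)"
  unfolding joint_def by (rule sets_bind[OF _ M.not_empty]) simp

lemma space_joint[simp]: "space joint = space (M \<Otimes>\<^sub>M replica_space)"
  by (rule sets_eq_imp_space_eq) simp

sublocale joint: prob_space joint
  unfolding joint_def
  by (rule prob_space_bind'[OF _ joint_kernel]) (simp add: space_prob_algebra M.prob_space_axioms)

lemma space_replicas: "\<omega> \<in> space M \<Longrightarrow> space (replicas \<omega>) = space replica_space"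
  by (rule sets_eq_imp_space_eq[OF sets_replicas])

lemma integral_joint:
  fixes H :: "'w \<times> (nat \<Rightarrow> 'h) \<Rightarrow> real"
  assumes H[measurable]: "H \<in> borel_measurable (M \<Otimes>\<^sub>M replica_space)"
    and bound: "\<And>z. z \<in> space (M \<Otimes>\<^sub>M replica_space) \<Longrightarrow> \<bar>H z\<bar> \<le> B"
  shows "(\<integral>z. H z \<partial>joint) = (\<integral>\<omega>. (\<integral>\<sigma>. H (\<omega>, \<sigma>) \<partial>replicas \<omega>) \<partial>M)"
proof -
  have "(\<integral>z. H z \<partial>joint) = (\<integral>\<omega>. (\<integral>z. H z \<partial>distr (replicas \<omega>) (M \<Otimes>\<^sub>M replica_space) (Pair \<omega>)) \<partial>M)"
    unfolding joint_def
    by (rule integral_bind[OF H _ measurable_prob_algebraD[OF joint_kernel], where B = B and B' = 1])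
      (auto simp: in_space_prob_algebra[OF measurable_space[OF joint_kernel]]
        intro: bound M.not_empty M.bounded_measure intro!: AE_I2)
  also have "\<dots> = (\<integral>\<omega>. (\<integral>\<sigma>. H (\<omega>, \<sigma>) \<partial>replicas \<omega>) \<partial>M)"
  proof (rule Bochner_Integration.integral_cong[OF refl])
    fix \<omega> assume \<omega>: "\<omega> \<in> space M"
    have "Pair \<omega> \<in> replica_space \<rightarrow>\<^sub>M M \<Otimes>\<^sub>M replica_space"
      using \<omega> by simp
    then have "Pair \<omega> \<in> replicas \<omega> \<rightarrow>\<^sub>M M \<Otimes>\<^sub>M replica_space"
      using measurable_cong_sets[OF sets_replicas[OF \<omega>] refl] by blast
    then show "(\<integral>z. H z \<partial>distr (replicas \<omega>) (M \<Otimes>\<^sub>M replica_space) (Pair \<omega>)) = (\<integral>\<sigma>. H (\<omega>, \<sigma>) \<partial>replicas \<omega>)"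
      by (rule integral_distr[OF _ H])
  qed
  finally show ?thesis .
qed

lemma component_measurable: "i \<ge> 1 \<Longrightarrow> (\<lambda>\<sigma>. \<sigma> i) \<in> replica_space \<rightarrow>\<^sub>M borel"
  by (rule measurable_component_singleton) simp

lemma integral_G_measurable:
  fixes H :: "('w \<times> (nat \<Rightarrow> 'h)) \<times> 'h \<Rightarrow> real"
  assumes H: "H \<in> borel_measurable ((M \<Otimes>\<^sub>M replica_space) \<Otimes>\<^sub>M borel)"
  shows "(\<lambda>z. \<integral>s. H (z, s) \<partial>G (fst z)) \<in> borel_measurable (M \<Otimes>\<^sub>M replica_space)"
proof -
  let ?N = "(M \<Otimes>\<^sub>M replica_space) \<Otimes>\<^sub>M (borel :: 'h measure)"
  have "(\<lambda>z. distr (G (fst z)) ?N (Pair z)) \<in> M \<Otimes>\<^sub>M replica_space \<rightarrow>\<^sub>M subprob_algebra ?N"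
    by (rule measurable_distr2[where M = borel]) simp_all
  then have "(\<lambda>z. integral\<^sup>L (distr (G (fst z)) ?N (Pair z)) H) \<in> borel_measurable (M \<Otimes>\<^sub>M replica_space)"
    by (rule measurable_compose[OF _ integral_measurable_subprob_algebra[OF H]])
  moreover have "integral\<^sup>L (distr (G (fst z)) ?N (Pair z)) H = (\<integral>s. H (z, s) \<partial>G (fst z))"
    if z: "z \<in> space (M \<Otimes>\<^sub>M replica_space)" for z
  proof (rule integral_distr[OF _ H])
    have "sets (G (fst z)) = sets borel" using z by (intro sets_G) (auto simp: space_pair_measure)
    moreover have "Pair z \<in> borel \<rightarrow>\<^sub>M ?N" using z by measurable
    ultimately show "Pair z \<in> G (fst z) \<rightarrow>\<^sub>M ?N" using measurable_cong_sets by blast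
  qed
  ultimately show ?thesis by (simp only: cong: measurable_cong)
qed

lemma integral_G_bound:
  fixes H :: "'h \<Rightarrow> real"
  assumes \<omega>: "\<omega> \<in> space M" and H: "H \<in> borel_measurable borel" and bound: "\<And>s. \<bar>H s\<bar> \<le> B"
  shows "integrable (G \<omega>) H" "\<bar>\<integral>s. H s \<partial>G \<omega>\<bar> \<le> B"
proof -
  interpret g: prob_space "G \<omega>" using prob_space_G[OF \<omega>] .
  have [measurable]: "H \<in> borel_measurable (G \<omega>)"
    using H measurable_cong_sets[OF sets_G[OF \<omega>] refl] by blast
  show int: "integrable (G \<omega>) H"
    by (rule g.integrable_const_bound[where B = B]) (auto simp: bound)
  have "\<bar>\<integral>s. H s \<partial>G \<omega>\<bar> \<le> (\<integral>s. \<bar>H s\<bar> \<partial>G \<omega>)"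
    by (rule integral_abs_bound)
  also have "\<dots> \<le> B"
    using int bound by (intro g.integral_le_const) auto
  finally show "\<bar>\<integral>s. H s \<partial>G \<omega>\<bar> \<le> B" .
qed

text \<open>An average over \<open>\<sigma>\<close> only, sampled from \<open>G\<close>, may be replaced by a replica that does not occur
  elsewhere.\<close>

lemma integral_joint_fresh_replica:
  fixes H :: "('w \<times> (nat \<Rightarrow> 'h)) \<times> 'h \<Rightarrow> real"
  assumes H[measurable]: "H \<in> borel_measurable ((M \<Otimes>\<^sub>M replica_space) \<Otimes>\<^sub>M borel)"
    and bound: "\<And>z s. z \<in> space (M \<Otimes>\<^sub>M replica_space) \<Longrightarrow> \<bar>H (z, s)\<bar> \<le> B"
    and k: "k \<ge> 1"
    and free: "\<And>\<omega> \<sigma> s s'. H ((\<omega>, \<sigma>(k := s)), s') = H ((\<omega>, \<sigma>), s')"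
  shows "(\<integral>z. (\<integral>s. H (z, s) \<partial>G (fst z)) \<partial>joint) = (\<integral>z. H (z, snd z k) \<partial>joint)"
proof -
  have Hs: "(\<lambda>s. H (z, s)) \<in> borel_measurable borel" if "z \<in> space (M \<Otimes>\<^sub>M replica_space)" for z
    using that by measurable
  have "(\<integral>z. (\<integral>s. H (z, s) \<partial>G (fst z)) \<partial>joint) = (\<integral>\<omega>. (\<integral>\<sigma>. (\<integral>s. H ((\<omega>, \<sigma>), s) \<partial>G \<omega>) \<partial>replicas \<omega>) \<partial>M)"
  proof (subst integral_joint[where B = B])
    show "(\<lambda>z. \<integral>s. H (z, s) \<partial>G (fst z)) \<in> borel_measurable (M \<Otimes>\<^sub>M replica_space)"
      by (rule integral_G_measurable[OF H])
    show "\<bar>\<integral>s. H (z, s) \<partial>G (fst z)\<bar> \<le> B" if "z \<in> space (M \<Otimes>\<^sub>M replica_space)" for z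
      using that by (intro integral_G_bound Hs bound) (auto simp: space_pair_measure)
  qed simp
  also have "\<dots> = (\<integral>\<omega>. (\<integral>\<sigma>. H ((\<omega>, \<sigma>), \<sigma> k) \<partial>replicas \<omega>) \<partial>M)"
  proof (rule Bochner_Integration.integral_cong[OF refl])
    fix \<omega> assume \<omega>: "\<omega> \<in> space M"
    have "sets (replicas \<omega> \<Otimes>\<^sub>M G \<omega>) = sets (replica_space \<Otimes>\<^sub>M (borel :: 'h measure))"
      by (intro sets_pair_measure_cong sets_G sets_replicas \<omega>)
    note cong = measurable_cong_sets[OF this refl]
    have "(\<lambda>(\<sigma>, s). H ((\<omega>, \<sigma>), s)) \<in> borel_measurable (replica_space \<Otimes>\<^sub>M borel)"
      using \<omega> by measurable
    then have "(\<lambda>(\<sigma>, s). H ((\<omega>, \<sigma>), s)) \<in> borel_measurable (replicas \<omega> \<Otimes>\<^sub>M G \<omega>)"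
      using cong by blast
    moreover have "\<bar>case z of (\<sigma>, s) \<Rightarrow> H ((\<omega>, \<sigma>), s)\<bar> \<le> B" if "z \<in> space (replicas \<omega> \<Otimes>\<^sub>M G \<omega>)" for z
      using that bound \<omega> space_replicas[OF \<omega>] by (auto simp: space_pair_measure)
    ultimately show "(\<integral>\<sigma>. (\<integral>s. H ((\<omega>, \<sigma>), s) \<partial>G \<omega>) \<partial>replicas \<omega>) = (\<integral>\<sigma>. H ((\<omega>, \<sigma>), \<sigma> k) \<partial>replicas \<omega>)"
      using integral_PiM_fresh_component[OF prob_space_G[OF \<omega>], of k "{1..}" "\<lambda>(\<sigma>, s). H ((\<omega>, \<sigma>), s)" B] k free
      unfolding replicas_def by auto
  qed
  also have "\<dots> = (\<integral>z. H (z, snd z k) \<partial>joint)"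
  proof (subst integral_joint[where B = B])
    show "(\<lambda>z. H (z, snd z k)) \<in> borel_measurable (M \<Otimes>\<^sub>M replica_space)"
      using component_measurable[OF k] by measurable
  qed (auto intro: bound)
  finally show ?thesis .
qed

text \<open>Exchangeability of the replicas.\<close>

lemma integral_joint_reindex:
  fixes H :: "'w \<times> (nat \<Rightarrow> 'h) \<Rightarrow> real"
  assumes H[measurable]: "H \<in> borel_measurable (M \<Otimes>\<^sub>M replica_space)"
    and bound: "\<And>z. z \<in> space (M \<Otimes>\<^sub>M replica_space) \<Longrightarrow> \<bar>H z\<bar> \<le> B"
    and \<tau>: "inj_on \<tau> {1..}" "\<tau> \<in> {1..} \<rightarrow> {1..}"
  shows "(\<integral>z. H (fst z, \<lambda>i\<in>{1..}. snd z (\<tau> i)) \<partial>joint) = (\<integral>z. H z \<partial>joint)"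
proof -
  have [measurable]: "(\<lambda>\<sigma>. \<lambda>i\<in>{1..}. \<sigma> (\<tau> i)) \<in> replica_space \<rightarrow>\<^sub>M replica_space"
    using \<tau> by (intro measurable_restrict measurable_component_singleton) auto
  have "(\<integral>z. H (fst z, \<lambda>i\<in>{1..}. snd z (\<tau> i)) \<partial>joint)
      = (\<integral>\<omega>. (\<integral>\<sigma>. H (\<omega>, \<lambda>i\<in>{1..}. \<sigma> (\<tau> i)) \<partial>replicas \<omega>) \<partial>M)"
  proof (subst integral_joint[where B = B])
    show m: "(\<lambda>z. H (fst z, \<lambda>i\<in>{1..}. snd z (\<tau> i))) \<in> borel_measurable (M \<Otimes>\<^sub>M replica_space)"
      by measurable
    show "\<bar>H (fst z, \<lambda>i\<in>{1..}. snd z (\<tau> i))\<bar> \<le> B" if "z \<in> space (M \<Otimes>\<^sub>M replica_space)" for z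
      using that by (intro bound) (auto simp: space_pair_measure space_PiM)
  qed simp
  also have "\<dots> = (\<integral>\<omega>. (\<integral>\<sigma>. H (\<omega>, \<sigma>) \<partial>replicas \<omega>) \<partial>M)"
  proof (rule Bochner_Integration.integral_cong[OF refl])
    fix \<omega> assume \<omega>: "\<omega> \<in> space M"
    have eq: "distr (replicas \<omega>) (replicas \<omega>) (\<lambda>\<sigma>. \<lambda>i\<in>{1..}. \<sigma> (\<tau> i)) = replicas \<omega>"
      using distr_PiM_reindex[of "{1..}" "\<lambda>_. G \<omega>" \<tau> "{1..}"] prob_space_G[OF \<omega>] \<tau>
      by (simp add: replicas_def)
    have "(\<lambda>\<sigma>. \<lambda>i\<in>{1..}. \<sigma> (\<tau> i)) \<in> replicas \<omega> \<rightarrow>\<^sub>M replicas \<omega>"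
      unfolding replicas_def using \<tau> by (intro measurable_restrict measurable_component_singleton) auto
    moreover have "(\<lambda>\<sigma>. H (\<omega>, \<sigma>)) \<in> borel_measurable replica_space"
      using \<omega> by measurable
    then have "(\<lambda>\<sigma>. H (\<omega>, \<sigma>)) \<in> borel_measurable (replicas \<omega>)"
      using measurable_cong_sets[OF sets_replicas[OF \<omega>] refl] by blast
    ultimately have "(\<integral>\<sigma>. H (\<omega>, \<sigma>) \<partial>distr (replicas \<omega>) (replicas \<omega>) (\<lambda>\<sigma>. \<lambda>i\<in>{1..}. \<sigma> (\<tau> i)))
        = (\<integral>\<sigma>. H (\<omega>, \<lambda>i\<in>{1..}. \<sigma> (\<tau> i)) \<partial>replicas \<omega>)"
      by (rule integral_distr)
    then show "(\<integral>\<sigma>. H (\<omega>, \<lambda>i\<in>{1..}. \<sigma> (\<tau> i)) \<partial>replicas \<omega>) = (\<integral>\<sigma>. H (\<omega>, \<sigma>) \<partial>replicas \<omega>)"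
      by (simp add: eq)
  qed
  also have "\<dots> = (\<integral>z. H z \<partial>joint)"
    by (rule integral_joint[symmetric, OF H bound])
  finally show ?thesis .
qed

lemma pair_kernel: "(\<lambda>\<omega>. G \<omega> \<Otimes>\<^sub>M G \<omega>) \<in> M \<rightarrow>\<^sub>M prob_algebra (borel \<Otimes>\<^sub>M borel)"
  using G_measurable G_measurable by measurable

lemma sets_overlap_law[simp, measurable_cong]: "sets (overlap_law M G) = sets borel"
  by (simp add: overlap_law_def)

lemma space_overlap_law[simp]: "space (overlap_law M G) = UNIV"
  by (simp add: overlap_law_def)

lemma sets_pair_bind:
  "sets (M \<bind> (\<lambda>\<omega>. G \<omega> \<Otimes>\<^sub>M G \<omega>)) = sets ((borel :: 'h measure) \<Otimes>\<^sub>M (borel :: 'h measure))"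
  by (rule sets_bind_measurable[OF measurable_prob_algebraD[OF pair_kernel] M.not_empty])

lemma inner_measurable_bind:
  "(\<lambda>(x, y). x \<bullet> y) \<in> borel_measurable (M \<bind> (\<lambda>\<omega>. G \<omega> \<Otimes>\<^sub>M G \<omega>))"
proof -
  have "(\<lambda>(x, y). x \<bullet> y) \<in> borel_measurable ((borel :: 'h measure) \<Otimes>\<^sub>M (borel :: 'h measure))"
    by measurable
  then show ?thesis
    using measurable_cong_sets[OF sets_pair_bind refl] by blast
qed

lemma prob_space_overlap_law: "prob_space (overlap_law M G)"
proof -
  have "prob_space (M \<bind> (\<lambda>\<omega>. G \<omega> \<Otimes>\<^sub>M G \<omega>))"
    by (rule prob_space_bind'[OF _ pair_kernel]) (simp add: space_prob_algebra M.prob_space_axioms)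
  then show ?thesis
    unfolding overlap_law_def by (rule prob_space.prob_space_distr[OF _ inner_measurable_bind])
qed

lemma borel_measurable_pair_G:
  fixes f :: "'z \<times> 'h \<Rightarrow> real"
  assumes \<omega>: "\<omega> \<in> space M" and f: "f \<in> borel_measurable (N' \<Otimes>\<^sub>M borel)" and sets: "sets N = sets N'"
  shows "f \<in> borel_measurable (N \<Otimes>\<^sub>M G \<omega>)"
  using f measurable_cong_sets[OF sets_pair_measure_cong[OF sets sets_G[OF \<omega>]] refl] by blast

text \<open>The law \<open>\<mu>\<close> is defined from two samples of \<open>G\<close>; here these are the first two replicas.\<close>

lemma integral_overlap_law:
  fixes \<psi> :: "real \<Rightarrow> real"
  assumes \<psi>[measurable]: "\<psi> \<in> borel_measurable borel" and bound: "\<And>x. \<bar>\<psi> x\<bar> \<le> B"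
  shows "(\<integral>x. \<psi> x \<partial>overlap_law M G) = (\<integral>z. \<psi> (overlap (snd z) 1 2) \<partial>joint)"
proof -
  have \<psi>_inner[measurable]: "(\<lambda>z. \<psi> (case z of (x, y) \<Rightarrow> x \<bullet> y)) \<in> borel_measurable ((borel :: 'h measure) \<Otimes>\<^sub>M (borel :: 'h measure))"
    by measurable
  have "(\<integral>x. \<psi> x \<partial>overlap_law M G) = (\<integral>z. \<psi> (case z of (x, y) \<Rightarrow> x \<bullet> y) \<partial>(M \<bind> (\<lambda>\<omega>. G \<omega> \<Otimes>\<^sub>M G \<omega>)))"
    unfolding overlap_law_def by (rule integral_distr[OF inner_measurable_bind \<psi>])
  also have "\<dots> = (\<integral>\<omega>. (\<integral>z. \<psi> (case z of (x, y) \<Rightarrow> x \<bullet> y) \<partial>(G \<omega> \<Otimes>\<^sub>M G \<omega>)) \<partial>M)"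
    by (rule integral_bind[OF \<psi>_inner _ measurable_prob_algebraD[OF pair_kernel], where B = B and B' = 1])
      (auto simp: prob_space.emeasure_space_1[OF prob_space_pair[OF prob_space_G prob_space_G]]
        intro: bound M.not_empty intro!: AE_I2)
  also have "\<dots> = (\<integral>\<omega>. (\<integral>\<sigma>. \<psi> (\<sigma> 1 \<bullet> \<sigma> 2) \<partial>replicas \<omega>) \<partial>M)"
  proof (rule Bochner_Integration.integral_cong[OF refl])
    fix \<omega> assume \<omega>: "\<omega> \<in> space M"
    interpret g: prob_space "G \<omega>" using prob_space_G[OF \<omega>] .
    interpret gg: pair_prob_space "G \<omega>" "G \<omega>" ..
    interpret r: prob_space "replicas \<omega>" using prob_space_replicas[OF \<omega>] .
    have replicas_eq: "sets (\<Pi>\<^sub>M l\<in>{1::nat..}. G \<omega>) = sets replica_space"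
      using sets_replicas[OF \<omega>] by (simp add: replicas_def)
    note [measurable] = component_measurable[of 1]
    have m1: "(\<lambda>z. \<psi> (fst z 1 \<bullet> snd z)) \<in> borel_measurable ((\<Pi>\<^sub>M l\<in>{1::nat..}. G \<omega>) \<Otimes>\<^sub>M G \<omega>)"
      by (rule borel_measurable_pair_G[OF \<omega> _ replicas_eq]) measurable
    have "(\<lambda>(u, s). \<psi> (u \<bullet> s)) \<in> borel_measurable (borel \<Otimes>\<^sub>M G \<omega>)"
      by (rule borel_measurable_pair_G[OF \<omega> _ refl]) measurable
    then have [measurable]: "(\<lambda>u. \<integral>s. \<psi> (u \<bullet> s) \<partial>G \<omega>) \<in> borel_measurable borel"
      by (rule g.borel_measurable_lebesgue_integral)
    have m2: "(\<lambda>z. \<integral>s. \<psi> (snd z \<bullet> s) \<partial>G \<omega>) \<in> borel_measurable ((\<Pi>\<^sub>M l\<in>{1::nat..}. G \<omega>) \<Otimes>\<^sub>M G \<omega>)"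
      by (rule borel_measurable_pair_G[OF \<omega> _ replicas_eq]) measurable
    have m3: "(\<lambda>z. \<psi> (case z of (x, y) \<Rightarrow> x \<bullet> y)) \<in> borel_measurable (G \<omega> \<Otimes>\<^sub>M G \<omega>)"
      by (rule borel_measurable_pair_G[OF \<omega> \<psi>_inner sets_G[OF \<omega>]])
    have "(\<integral>z. \<psi> (case z of (x, y) \<Rightarrow> x \<bullet> y) \<partial>(G \<omega> \<Otimes>\<^sub>M G \<omega>)) = (\<integral>u. (\<integral>s. \<psi> (u \<bullet> s) \<partial>G \<omega>) \<partial>G \<omega>)"
      by (subst gg.integral_fst'[symmetric])
        (auto intro!: gg.P.integrable_const_bound[where B = B] bound m3)
    also have "\<dots> = (\<integral>\<sigma>. (\<integral>u. (\<integral>s. \<psi> (u \<bullet> s) \<partial>G \<omega>) \<partial>G \<omega>) \<partial>replicas \<omega>)"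
      by (simp add: r.prob_space)
    also have "\<dots> = (\<integral>\<sigma>. (\<integral>s. \<psi> (\<sigma> 1 \<bullet> s) \<partial>G \<omega>) \<partial>replicas \<omega>)"
      unfolding replicas_def
      by (rule integral_PiM_fresh_component[where H = "\<lambda>z. \<integral>s. \<psi> (snd z \<bullet> s) \<partial>G \<omega>" and B = B, unfolded fst_conv snd_conv])
        (auto intro!: integral_G_bound bound \<omega> m2 g.prob_space_axioms)
    also have "\<dots> = (\<integral>\<sigma>. \<psi> (\<sigma> 1 \<bullet> \<sigma> 2) \<partial>replicas \<omega>)"
      unfolding replicas_def
      by (rule integral_PiM_fresh_component[where H = "\<lambda>z. \<psi> (fst z 1 \<bullet> snd z)" and B = B, unfolded fst_conv snd_conv])
        (auto intro!: bound m1 g.prob_space_axioms)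
    finally show "(\<integral>z. \<psi> (case z of (x, y) \<Rightarrow> x \<bullet> y) \<partial>(G \<omega> \<Otimes>\<^sub>M G \<omega>)) = (\<integral>\<sigma>. \<psi> (\<sigma> 1 \<bullet> \<sigma> 2) \<partial>replicas \<omega>)" .
  qed
  also have "\<dots> = (\<integral>z. \<psi> (overlap (snd z) 1 2) \<partial>joint)"
    by (subst integral_joint[where B = B]) (auto simp: overlap_def bound)
  finally show ?thesis .
qed

end

context random_measure
begin

abbreviation square :: "nat \<Rightarrow> (nat \<times> nat) set" where
  "square m \<equiv> {1..m} \<times> {1..m}"

lemma overlap_measurable:
  assumes "l \<ge> 1" "l' \<ge> 1"
  shows "(\<lambda>\<sigma>. overlap \<sigma> l l') \<in> borel_measurable replica_space"
  unfolding overlap_def using assms by (intro borel_measurable_inner component_measurable)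

lemma overlap_array_measurable:
  assumes "I \<subseteq> {1..} \<times> {1..}"
  shows "overlap_array I \<in> replica_space \<rightarrow>\<^sub>M array_space I"
  unfolding overlap_array_def using assms
  by (intro measurable_restrict) (auto intro!: overlap_measurable simp: case_prod_beta')

lemma overlap_array_in_space: "overlap_array I \<sigma> \<in> space (array_space I)"
  by (simp add: overlap_array_def space_PiM)

lemma square_array_measurable[measurable]: "overlap_array (square m) \<in> replica_space \<rightarrow>\<^sub>M array_space (square m)"
  by (rule overlap_array_measurable) auto

lemma integral_replica_average:
  fixes h :: "(nat \<Rightarrow> 'h) \<Rightarrow> real"
  assumes [measurable]: "h \<in> borel_measurable replica_space" and bound: "\<And>\<sigma>. \<bar>h \<sigma>\<bar> \<le> B"
  shows "(\<integral>\<omega>. replica_average (G \<omega>) h \<partial>M) = (\<integral>z. h (snd z) \<partial>joint)"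
  unfolding replica_average_eq by (subst integral_joint[where B = B]) (auto intro: bound)

end

section \<open>The Ghirlanda-Guerra identities for functions of arrays\<close>

text \<open>A random measure that satisfies the Ghirlanda-Guerra identities.\<close>

locale ghirlanda_guerra_measure = random_measure M G
  for M :: "'w measure" and G :: "'w \<Rightarrow> 'h::{real_inner, polish_space} measure" +
  assumes ghirlanda_guerra: "ghirlanda_guerra M G"
begin

abbreviation \<mu> :: "real measure" where
  "\<mu> \<equiv> overlap_law M G"

sublocale \<mu>: prob_space \<mu>
  by (rule prob_space_overlap_law)

lemma ghirlanda_guerra_product:
  assumes m: "m \<ge> 2"
    and u: "u \<in> borel_measurable (array_space (square m))" "\<And>a. a \<in> space (array_space (square m)) \<Longrightarrow> \<bar>u a\<bar> \<le> B"
    and \<psi>: "\<psi> \<in> borel_measurable borel" "\<And>x. \<bar>\<psi> x\<bar> \<le> B'"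
  shows "real m * (\<integral>z. u (overlap_array (square m) (snd z)) * \<psi> (overlap (snd z) 1 (m + 1)) \<partial>joint) =
    (\<integral>z. u (overlap_array (square m) (snd z)) \<partial>joint) * (\<integral>x. \<psi> x \<partial>\<mu>)
    + (\<Sum>l = 2..m. \<integral>z. u (overlap_array (square m) (snd z)) * \<psi> (overlap (snd z) 1 l) \<partial>joint)"
proof -
  have ub: "\<bar>u (overlap_array (square m) \<sigma>)\<bar> \<le> B" for \<sigma> :: "nat \<Rightarrow> 'h"
    by (intro u overlap_array_in_space)
  have B: "B \<ge> 0" by (rule order.trans[OF abs_ge_zero ub[of undefined]])
  have B': "B' \<ge> 0" using \<psi>(2)[of 0] by linarith
  have mu: "(\<lambda>\<sigma>. u (overlap_array (square m) \<sigma>)) \<in> borel_measurable replica_space"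
    using u(1) by measurable
  have m\<psi>: "(\<lambda>\<sigma>. \<psi> (overlap \<sigma> 1 l)) \<in> borel_measurable replica_space" if "l \<ge> 1" for l
    using that by (intro measurable_compose[OF overlap_measurable \<psi>(1)]) auto
  have avg: "(\<integral>\<omega>. replica_average (G \<omega>) (\<lambda>\<sigma>. u (overlap_array (square m) \<sigma>) * \<psi> (overlap \<sigma> 1 l)) \<partial>M)
      = (\<integral>z. u (overlap_array (square m) (snd z)) * \<psi> (overlap (snd z) 1 l) \<partial>joint)" if "l \<ge> 1" for l
    using that
    by (intro integral_replica_average[where B = "B * B'"] borel_measurable_times mu m\<psi>)
      (auto simp: abs_mult intro!: mult_mono ub \<psi>(2) B)
  have u_term: "(\<integral>\<omega>. replica_average (G \<omega>) (\<lambda>\<sigma>. u (overlap_array (square m) \<sigma>)) \<partial>M)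
      = (\<integral>z. u (overlap_array (square m) (snd z)) \<partial>joint)"
    by (rule integral_replica_average[OF mu ub])
  have \<psi>_term: "(\<integral>\<omega>. replica_average (G \<omega>) (\<lambda>\<sigma>. \<psi> (overlap \<sigma> 1 2)) \<partial>M) = (\<integral>x. \<psi> x \<partial>\<mu>)"
    by (subst integral_replica_average[OF m\<psi> \<psi>(2)]) (auto simp: integral_overlap_law[OF \<psi>])
  have bm: "bounded_measurable (array_space (square m)) u" "bounded_measurable borel \<psi>"
    using u \<psi> by (auto simp: bounded_measurable_def bounded_iff)
  have gg: "(\<integral>\<omega>. replica_average (G \<omega>) (\<lambda>\<sigma>. u (overlap_array (square m) \<sigma>) * \<psi> (overlap \<sigma> 1 (m + 1))) \<partial>M) =
        1 / real m
          * (\<integral>\<omega>. replica_average (G \<omega>) (\<lambda>\<sigma>. u (overlap_array (square m) \<sigma>)) \<partial>M)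
          * (\<integral>\<omega>. replica_average (G \<omega>) (\<lambda>\<sigma>. \<psi> (overlap \<sigma> 1 2)) \<partial>M)
        + 1 / real m
          * (\<Sum>l = 2..m. \<integral>\<omega>. replica_average (G \<omega>)
               (\<lambda>\<sigma>. u (overlap_array (square m) \<sigma>) * \<psi> (overlap \<sigma> 1 l)) \<partial>M)"
    using ghirlanda_guerra[unfolded ghirlanda_guerra_def, rule_format, OF m bm] .
  have sum: "(\<Sum>l = 2..m. \<integral>\<omega>. replica_average (G \<omega>) (\<lambda>\<sigma>. u (overlap_array (square m) \<sigma>) * \<psi> (overlap \<sigma> 1 l)) \<partial>M)
      = (\<Sum>l = 2..m. \<integral>z. u (overlap_array (square m) (snd z)) * \<psi> (overlap (snd z) 1 l) \<partial>joint)"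
    by (intro sum.cong refl avg) auto
  show ?thesis
    using gg m unfolding sum u_term \<psi>_term avg[OF le_add2] by (simp add: field_simps)
qed

text \<open>The identities for \<open>n = 1\<close> follow from those for \<open>n = 2\<close>: given the first replica, the
  overlaps \<open>R\<^sub>1\<^sub>,\<^sub>2\<close> and \<open>R\<^sub>1\<^sub>,\<^sub>3\<close> have the same law.\<close>

lemma ghirlanda_guerra_product_1:
  fixes u :: "(nat \<times> nat \<Rightarrow> real) \<Rightarrow> real" and \<psi> :: "real \<Rightarrow> real"
  assumes u: "u \<in> borel_measurable (array_space (square 1))" "\<And>a. a \<in> space (array_space (square 1)) \<Longrightarrow> \<bar>u a\<bar> \<le> B"
    and \<psi>: "\<psi> \<in> borel_measurable borel" "\<And>x. \<bar>\<psi> x\<bar> \<le> B'"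
  shows "(\<integral>z. u (overlap_array (square 1) (snd z)) * \<psi> (overlap (snd z) 1 2) \<partial>joint) =
    (\<integral>z. u (overlap_array (square 1) (snd z)) \<partial>joint) * (\<integral>x. \<psi> x \<partial>\<mu>)"
proof -
  let ?a = "\<lambda>z :: 'w \<times> (nat \<Rightarrow> 'h). overlap_array (square 1) (snd z)"
  have sub: "square 1 \<subseteq> square 2" by auto
  have restr: "restrict (overlap_array (square 2) \<sigma>) (square 1) = overlap_array (square 1) \<sigma>" for \<sigma> :: "nat \<Rightarrow> 'h"
    using sub by (auto simp: overlap_array_def fun_eq_iff)
  have ub: "\<bar>u (overlap_array (square 1) \<sigma>)\<bar> \<le> B" for \<sigma> :: "nat \<Rightarrow> 'h"
    by (intro u overlap_array_in_space)
  have B: "B \<ge> 0" by (rule order.trans[OF abs_ge_zero ub[of undefined]])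
  have "(\<lambda>a. restrict a (square 1)) \<in> array_space (square 2) \<rightarrow>\<^sub>M array_space (square 1)"
    by (rule measurable_restrict_subset[OF sub])
  note m_restr = measurable_compose[OF this u(1)]
  have "\<bar>u (restrict a (square 1))\<bar> \<le> B" for a
    by (intro u) (auto simp: space_PiM)
  note gg = ghirlanda_guerra_product[OF order_refl m_restr this \<psi>, unfolded restr]
  define \<tau> :: "nat \<Rightarrow> nat" where "\<tau> = id(2 := 3, 3 := 2)"
  have \<tau>: "inj_on \<tau> {1..}" "\<tau> \<in> {1..} \<rightarrow> {1..}"
    by (auto simp: \<tau>_def inj_on_def)
  have m\<psi>: "(\<lambda>\<sigma>. \<psi> (overlap \<sigma> 1 3)) \<in> borel_measurable replica_space"
    by (intro measurable_compose[OF overlap_measurable \<psi>(1)]) auto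
  note [measurable] = u(1) m\<psi>
  have "(\<integral>z. u (?a z) * \<psi> (overlap (snd z) 1 2) \<partial>joint) = (\<integral>z. u (?a z) * \<psi> (overlap (snd z) 1 3) \<partial>joint)"
  proof (subst integral_joint_reindex[OF _ _ \<tau>, symmetric, of "\<lambda>z. u (?a z) * \<psi> (overlap (snd z) 1 3)" "B * B'"])
    have "overlap_array (square 1) (\<lambda>i\<in>{1..}. \<sigma> (\<tau> i)) = overlap_array (square 1) \<sigma>" for \<sigma> :: "nat \<Rightarrow> 'h"
      by (auto simp: overlap_array_def overlap_def \<tau>_def)
    moreover have "overlap (\<lambda>i\<in>{1..}. \<sigma> (\<tau> i)) 1 3 = overlap \<sigma> 1 2" for \<sigma> :: "nat \<Rightarrow> 'h"
      by (simp add: overlap_def \<tau>_def)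
    ultimately show "(\<integral>z. u (?a z) * \<psi> (overlap (snd z) 1 2) \<partial>joint) =
      (\<integral>z. u (?a (fst z, \<lambda>i\<in>{1..}. snd z (\<tau> i))) * \<psi> (overlap (snd (fst z, \<lambda>i\<in>{1..}. snd z (\<tau> i))) 1 3) \<partial>joint)"
      by simp
    show "(\<lambda>z. u (?a z) * \<psi> (overlap (snd z) 1 3)) \<in> borel_measurable (M \<Otimes>\<^sub>M replica_space)"
      by measurable
  qed (auto simp: abs_mult intro!: mult_mono ub[simplified] \<psi>(2) B)
  moreover have "{2..2::nat} = {2}" by auto
  ultimately show ?thesis
    using gg by simp
qed

text \<open>The right-hand side of the identities is the integral with respect to the law obtained by
  choosing \<open>l\<close> uniformly in \<open>{1..m}\<close>, and then \<open>R\<^sub>1\<^sub>,\<^sub>l\<close> if \<open>l \<noteq> 1\<close> and an independent sample of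
  \<open>\<mu>\<close> if \<open>l = 1\<close>. The identities say that this law agrees on rectangles with the law of the overlaps
  of \<open>m\<close> replicas together with \<open>R\<^sub>1\<^sub>,\<^sub>m\<^sub>+\<^sub>1\<close>, so the two laws are equal.\<close>

lemma ghirlanda_guerra_array_1:
  assumes m: "m \<ge> 1"
    and \<Psi>[measurable]: "\<Psi> \<in> borel_measurable (array_space (square m) \<Otimes>\<^sub>M borel)"
    and bound: "\<And>a x. a \<in> space (array_space (square m)) \<Longrightarrow> \<bar>\<Psi> (a, x)\<bar> \<le> B"
  shows "real m * (\<integral>z. \<Psi> (overlap_array (square m) (snd z), overlap (snd z) 1 (m + 1)) \<partial>joint) =
    (\<integral>z. (\<integral>x. \<Psi> (overlap_array (square m) (snd z), x) \<partial>\<mu>) \<partial>joint)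
    + (\<Sum>l = 2..m. \<integral>z. \<Psi> (overlap_array (square m) (snd z), overlap (snd z) 1 l) \<partial>joint)"
proof -
  \<comment> \<open>\<open>X\<close> samples the left-hand side, and \<open>Y\<close> the mixture on the right-hand side.\<close>
  let ?N = "array_space (square m) \<Otimes>\<^sub>M (borel :: real measure)"
  let ?a = "\<lambda>z :: 'w \<times> (nat \<Rightarrow> 'h). overlap_array (square m) (snd z)"
  let ?U = "uniform_count_measure {1..m}"
  define X where "X = (\<lambda>z :: 'w \<times> (nat \<Rightarrow> 'h). (?a z, overlap (snd z) 1 (m + 1)))"
  define Y where "Y = (\<lambda>(l, z :: 'w \<times> (nat \<Rightarrow> 'h), x). (?a z, if l = 1 then x else overlap (snd z) 1 l))"
  have ov: "(\<lambda>z. overlap (snd z) 1 l) \<in> borel_measurable (M \<Otimes>\<^sub>M replica_space)" if "l \<ge> 1" for l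
    using overlap_measurable[of 1 l] that by measurable
  have X[measurable]: "X \<in> joint \<rightarrow>\<^sub>M ?N"
    using ov[of "m + 1"] unfolding X_def by measurable
  have "Y \<in> count_space {1..m} \<Otimes>\<^sub>M (joint \<Otimes>\<^sub>M \<mu>) \<rightarrow>\<^sub>M ?N"
  proof (rule measurable_pair_measure_countable1)
    fix l assume "l \<in> {1..m}"
    then have [measurable]: "(\<lambda>z. overlap (snd z) 1 l) \<in> borel_measurable (M \<Otimes>\<^sub>M replica_space)"
      by (intro ov) auto
    have "(\<lambda>y. Y (l, y)) = (\<lambda>y. (?a (fst y), if l = 1 then snd y else overlap (snd (fst y)) 1 l))"
      by (auto simp: Y_def)
    also have "\<dots> \<in> (M \<Otimes>\<^sub>M replica_space) \<Otimes>\<^sub>M borel \<rightarrow>\<^sub>M ?N"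
      by measurable
    finally show "(\<lambda>y. Y (l, y)) \<in> joint \<Otimes>\<^sub>M \<mu> \<rightarrow>\<^sub>M ?N"
      using measurable_cong_sets[OF sets_pair_measure_cong[OF sets_joint sets_overlap_law] refl] by blast
  qed simp
  then have Y[measurable]: "Y \<in> ?U \<Otimes>\<^sub>M (joint \<Otimes>\<^sub>M \<mu>) \<rightarrow>\<^sub>M ?N"
    by (simp cong: measurable_cong_sets add: sets_pair_measure_cong[OF sets_uniform_count_measure_count_space refl])
  interpret U: prob_space ?U
    using m by (intro prob_space_uniform_count_measure) auto
  interpret J\<mu>: pair_prob_space joint \<mu> ..
  interpret UJ\<mu>: pair_prob_space ?U "joint \<Otimes>\<^sub>M \<mu>" ..
  have Y_space: "fst (Y w) \<in> space (array_space (square m))" for w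
    by (auto simp: Y_def overlap_array_in_space split: prod.split)
  have int_Y: "(\<integral>w. h (Y w) \<partial>(?U \<Otimes>\<^sub>M (joint \<Otimes>\<^sub>M \<mu>))) = ((\<integral>z. (\<integral>x. h (?a z, x) \<partial>\<mu>) \<partial>joint)
      + (\<Sum>l = 2..m. \<integral>z. h (?a z, overlap (snd z) 1 l) \<partial>joint)) / real m"
    if [measurable]: "h \<in> borel_measurable ?N"
      and b: "\<And>a x. a \<in> space (array_space (square m)) \<Longrightarrow> \<bar>h (a, x)\<bar> \<le> B" for h :: "(nat \<times> nat \<Rightarrow> real) \<times> real \<Rightarrow> real" and B
  proof -
    have bY: "\<bar>h (Y w)\<bar> \<le> B" for w
      using b[OF Y_space[of w], of "snd (Y w)"] by simp
    have "(\<integral>w. h (Y w) \<partial>(?U \<Otimes>\<^sub>M (joint \<Otimes>\<^sub>M \<mu>))) = (\<integral>l. (\<integral>y. h (Y (l, y)) \<partial>(joint \<Otimes>\<^sub>M \<mu>)) \<partial>?U)"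
      by (rule UJ\<mu>.integral_fst'[symmetric]) (auto intro!: UJ\<mu>.P.integrable_const_bound[where B = B] bY)
    also have "\<dots> = (\<Sum>l\<in>{1..m}. \<integral>y. h (Y (l, y)) \<partial>(joint \<Otimes>\<^sub>M \<mu>)) / real m"
      by (simp add: integral_uniform_count_measure)
    also have "(\<Sum>l\<in>{1..m}. \<integral>y. h (Y (l, y)) \<partial>(joint \<Otimes>\<^sub>M \<mu>))
        = (\<Sum>l\<in>{1..m}. \<integral>z. (\<integral>x. h (Y (l, z, x)) \<partial>\<mu>) \<partial>joint)"
    proof (rule sum.cong[OF refl])
      fix l assume l: "l \<in> {1..m}"
      then have "l \<in> space ?U" by (simp add: space_uniform_count_measure)
      from measurable_compose[OF measurable_Pair1'[OF this] measurable_compose[OF Y that(1)]]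
      have "(\<lambda>y. h (Y (l, y))) \<in> borel_measurable (joint \<Otimes>\<^sub>M \<mu>)" .
      then show "(\<integral>y. h (Y (l, y)) \<partial>(joint \<Otimes>\<^sub>M \<mu>)) = (\<integral>z. (\<integral>x. h (Y (l, z, x)) \<partial>\<mu>) \<partial>joint)"
        by (intro J\<mu>.integral_fst'[symmetric] J\<mu>.P.integrable_const_bound[where B = B]) (auto intro: bY)
    qed
    also have "(\<Sum>l\<in>{1..m}. \<integral>z. (\<integral>x. h (Y (l, z, x)) \<partial>\<mu>) \<partial>joint)
        = (\<integral>z. (\<integral>x. h (?a z, x) \<partial>\<mu>) \<partial>joint) + (\<Sum>l = 2..m. \<integral>z. h (?a z, overlap (snd z) 1 l) \<partial>joint)"
      using m by (subst sum.atLeast_Suc_atMost) (auto simp: Y_def \<mu>.prob_space[simplified] numeral_2_eq_2 One_nat_def)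
    finally show ?thesis .
  qed
  have rect: "real m * (\<integral>z. u (?a z) * \<psi> (overlap (snd z) 1 (m + 1)) \<partial>joint) =
      (\<integral>z. u (?a z) \<partial>joint) * (\<integral>x. \<psi> x \<partial>\<mu>) + (\<Sum>l = 2..m. \<integral>z. u (?a z) * \<psi> (overlap (snd z) 1 l) \<partial>joint)"
    if "u \<in> borel_measurable (array_space (square m))" "\<And>a. a \<in> space (array_space (square m)) \<Longrightarrow> \<bar>u a\<bar> \<le> 1"
      "\<psi> \<in> borel_measurable borel" "\<And>x. \<bar>\<psi> x\<bar> \<le> 1" for u :: "(nat \<times> nat \<Rightarrow> real) \<Rightarrow> real" and \<psi> :: "real \<Rightarrow> real"
  proof (cases "m = 1")
    case True
    have "\<And>a. a \<in> space (array_space (square 1)) \<Longrightarrow> \<bar>u a\<bar> \<le> 1" "u \<in> borel_measurable (array_space (square 1))"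
      using that True by auto
    then show ?thesis
      using ghirlanda_guerra_product_1[of u 1 \<psi> 1] that(3,4) True by simp
  next
    case False
    then show ?thesis
      using that m by (intro ghirlanda_guerra_product[where B = 1 and B' = 1]) auto
  qed
  have "distr joint ?N X = distr (?U \<Otimes>\<^sub>M (joint \<Otimes>\<^sub>M \<mu>)) ?N Y"
  proof (rule measure_eqI_generator_eq[OF Int_stable_pair_measure_generator, where \<Omega> = "space ?N" and A = "\<lambda>_. space ?N"])
    fix R assume "R \<in> {S \<times> T | S T. S \<in> sets (array_space (square m)) \<and> T \<in> sets (borel :: real measure)}"
    then obtain S T where R: "R = S \<times> T" and S[measurable]: "S \<in> sets (array_space (square m))" and T[measurable]: "T \<in> sets borel"
      by blast
    have R_sets: "R \<in> sets ?N" unfolding R by measurable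
    have ind: "indicat_real R (a, x) = indicat_real S a * indicat_real T x" for a x
      by (auto simp: R indicator_def)
    have "measure (distr joint ?N X) R = (\<integral>p. indicat_real R p \<partial>distr joint ?N X)"
      using R_sets by (simp add: sets.Int_space_eq2)
    also have "\<dots> = (\<integral>z. indicat_real R (X z) \<partial>joint)"
      using R_sets by (intro integral_distr) auto
    also have "\<dots> = ((\<integral>z. indicat_real S (?a z) \<partial>joint) * (\<integral>x. indicat_real T x \<partial>\<mu>)
        + (\<Sum>l = 2..m. \<integral>z. indicat_real S (?a z) * indicat_real T (overlap (snd z) 1 l) \<partial>joint)) / real m"
      using rect[of "indicat_real S" "indicat_real T"] m by (simp add: X_def ind field_simps indicator_abs_le_1)
    also have "\<dots> = ((\<integral>z. (\<integral>x. indicat_real R (?a z, x) \<partial>\<mu>) \<partial>joint)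
        + (\<Sum>l = 2..m. \<integral>z. indicat_real R (?a z, overlap (snd z) 1 l) \<partial>joint)) / real m"
      by (simp add: ind)
    also have "\<dots> = (\<integral>w. indicat_real R (Y w) \<partial>(?U \<Otimes>\<^sub>M (joint \<Otimes>\<^sub>M \<mu>)))"
      by (rule int_Y[symmetric, of "indicat_real R" 1])
        (use R_sets in \<open>auto simp: indicator_abs_le_1\<close>)
    also have "\<dots> = (\<integral>p. indicat_real R p \<partial>distr (?U \<Otimes>\<^sub>M (joint \<Otimes>\<^sub>M \<mu>)) ?N Y)"
      using R_sets by (intro integral_distr[symmetric]) auto
    also have "\<dots> = measure (distr (?U \<Otimes>\<^sub>M (joint \<Otimes>\<^sub>M \<mu>)) ?N Y) R"
      using R_sets by (simp add: sets.Int_space_eq2)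
    finally show "emeasure (distr joint ?N X) R = emeasure (distr (?U \<Otimes>\<^sub>M (joint \<Otimes>\<^sub>M \<mu>)) ?N Y) R"
      using joint.prob_space_distr[OF X] UJ\<mu>.P.prob_space_distr[OF Y]
      by (simp add: finite_measure.emeasure_eq_measure prob_space.finite_measure)
  next
    show "emeasure (distr joint ?N X) (space ?N) \<noteq> \<infinity>"
      using prob_space.emeasure_space_1[OF joint.prob_space_distr[OF X]] by simp
    show "range (\<lambda>_. space ?N) \<subseteq> {S \<times> T | S T. S \<in> sets (array_space (square m)) \<and> T \<in> sets (borel :: real measure)}"
      unfolding space_pair_measure by blast
    show "{S \<times> T | S T. S \<in> sets (array_space (square m)) \<and> T \<in> sets (borel :: real measure)} \<subseteq> Pow (space ?N)"
      unfolding space_pair_measure by (rule pair_measure_closed)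
  qed (simp_all add: sets_pair_measure space_pair_measure)
  then have "(\<integral>p. \<Psi> p \<partial>distr joint ?N X) = (\<integral>p. \<Psi> p \<partial>distr (?U \<Otimes>\<^sub>M (joint \<Otimes>\<^sub>M \<mu>)) ?N Y)"
    by simp
  then have "(\<integral>z. \<Psi> (X z) \<partial>joint) = (\<integral>w. \<Psi> (Y w) \<partial>(?U \<Otimes>\<^sub>M (joint \<Otimes>\<^sub>M \<mu>)))"
    unfolding integral_distr[OF X \<Psi>] integral_distr[OF Y \<Psi>] .
  then show ?thesis
    using int_Y[OF \<Psi> bound] m by (simp add: X_def field_simps)
qed

text \<open>By exchangeability the first replica may be replaced by any other of the \<open>m\<close> replicas; \<open>\<tau>\<close> below
  exchanges \<open>1\<close> and \<open>j\<close>, and \<open>\<pi>\<close> is its action on arrays.\<close>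

lemma ghirlanda_guerra_array:
  assumes j: "j \<in> {1..m}"
    and \<Psi>[measurable]: "\<Psi> \<in> borel_measurable (array_space (square m) \<Otimes>\<^sub>M borel)"
    and bound: "\<And>a x. a \<in> space (array_space (square m)) \<Longrightarrow> \<bar>\<Psi> (a, x)\<bar> \<le> B"
  shows "real m * (\<integral>z. \<Psi> (overlap_array (square m) (snd z), overlap (snd z) j (m + 1)) \<partial>joint) =
    (\<integral>z. (\<integral>x. \<Psi> (overlap_array (square m) (snd z), x) \<partial>\<mu>) \<partial>joint)
    + (\<Sum>l\<in>{1..m} - {j}. \<integral>z. \<Psi> (overlap_array (square m) (snd z), overlap (snd z) j l) \<partial>joint)"
proof -
  have m: "m \<ge> 1" using j by auto
  let ?a = "\<lambda>\<sigma> :: nat \<Rightarrow> 'h. overlap_array (square m) \<sigma>"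
  define \<tau> where "\<tau> = id(1 := j, j := 1)"
  have \<tau>: "inj_on \<tau> {1..}" "\<tau> \<in> {1..} \<rightarrow> {1..}" and \<tau>1: "\<tau> j = 1" "\<tau> 1 = j" "\<tau> (m + 1) = m + 1"
    and \<tau>_m: "\<And>l. l \<in> {1..m} \<Longrightarrow> \<tau> l \<in> {1..m}" and \<tau>_\<tau>: "\<And>l. \<tau> (\<tau> l) = l"
    using j by (auto simp: \<tau>_def inj_on_def)
  define \<pi> where "\<pi> = (\<lambda>a :: nat \<times> nat \<Rightarrow> real. \<lambda>(l, l')\<in>square m. a (\<tau> l, \<tau> l'))"
  have \<pi>_restrict: "\<pi> = (\<lambda>a. \<lambda>p\<in>square m. a (\<tau> (fst p), \<tau> (snd p)))"
    by (auto simp: \<pi>_def fun_eq_iff)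
  have \<pi>[measurable]: "\<pi> \<in> array_space (square m) \<rightarrow>\<^sub>M array_space (square m)"
    unfolding \<pi>_restrict by (intro measurable_restrict measurable_component_singleton) (use \<tau>_m in force)
  have \<pi>_space: "\<pi> a \<in> space (array_space (square m))" for a
    by (simp add: \<pi>_restrict space_PiM)
  let ?s = "\<lambda>\<sigma> :: nat \<Rightarrow> 'h. \<lambda>i\<in>{1..}. \<sigma> (\<tau> i)"
  have a_\<tau>: "?a (?s \<sigma>) = \<pi> (?a \<sigma>)" for \<sigma>
  proof
    fix p show "?a (?s \<sigma>) p = \<pi> (?a \<sigma>) p"
      using \<tau>_m[of "fst p"] \<tau>_m[of "snd p"] by (cases p) (auto simp: \<pi>_def overlap_array_def overlap_def)
  qed
  have ov_\<tau>: "overlap (?s \<sigma>) l l' = overlap \<sigma> (\<tau> l) (\<tau> l')" if "l \<ge> 1" "l' \<ge> 1" for \<sigma> l l'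
    using that by (simp add: overlap_def)
  have swap: "(\<integral>z. \<Psi> (\<pi> (?a (snd z)), overlap (snd z) 1 (\<tau> l)) \<partial>joint) = (\<integral>z. \<Psi> (?a (snd z), overlap (snd z) j l) \<partial>joint)"
    if l: "l \<ge> 1" for l
  proof -
    have [measurable]: "(\<lambda>\<sigma>. overlap \<sigma> j l) \<in> borel_measurable replica_space"
      using l j by (intro overlap_measurable) auto
    have "(\<integral>z. \<Psi> (?a (?s (snd z)), overlap (?s (snd z)) j l) \<partial>joint) = (\<integral>z. \<Psi> (?a (snd z), overlap (snd z) j l) \<partial>joint)"
      by (rule integral_joint_reindex[where H = "\<lambda>z. \<Psi> (?a (snd z), overlap (snd z) j l)" and B = B, unfolded snd_conv, OF _ _ \<tau>])
        (measurable, auto intro!: bound overlap_array_in_space)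
    then show ?thesis
      using l j by (simp add: a_\<tau> ov_\<tau> \<tau>1)
  qed
  have swap_\<mu>: "(\<integral>z. (\<integral>x. \<Psi> (\<pi> (?a (snd z)), x) \<partial>\<mu>) \<partial>joint) = (\<integral>z. (\<integral>x. \<Psi> (?a (snd z), x) \<partial>\<mu>) \<partial>joint)"
  proof -
    have [measurable]: "\<Psi> \<in> borel_measurable (array_space (square m) \<Otimes>\<^sub>M \<mu>)"
      using \<Psi> measurable_cong_sets[OF sets_pair_measure_cong[OF refl sets_overlap_law] refl] by blast
    have "(\<integral>z. (\<integral>x. \<Psi> (?a (?s (snd z)), x) \<partial>\<mu>) \<partial>joint) = (\<integral>z. (\<integral>x. \<Psi> (?a (snd z), x) \<partial>\<mu>) \<partial>joint)"
    proof (rule integral_joint_reindex[where H = "\<lambda>z. \<integral>x. \<Psi> (?a (snd z), x) \<partial>\<mu>" and B = B, unfolded snd_conv, OF _ _ \<tau>])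
      show "(\<lambda>z. \<integral>x. \<Psi> (?a (snd z), x) \<partial>\<mu>) \<in> borel_measurable (M \<Otimes>\<^sub>M replica_space)"
        by measurable
      fix z :: "'w \<times> (nat \<Rightarrow> 'h)"
      have int: "integrable \<mu> (\<lambda>x. \<Psi> (?a (snd z), x))"
        using overlap_array_in_space[of "square m" "snd z"]
        by (intro \<mu>.integrable_const_bound[where B = B] AE_I2) (auto intro!: bound overlap_array_in_space)
      have "\<bar>\<integral>x. \<Psi> (?a (snd z), x) \<partial>\<mu>\<bar> \<le> (\<integral>x. \<bar>\<Psi> (?a (snd z), x)\<bar> \<partial>\<mu>)"
        by (rule integral_abs_bound)
      also have "\<dots> \<le> B"
        using int by (intro \<mu>.integral_le_const) (auto intro!: bound overlap_array_in_space)
      finally show "\<bar>\<integral>x. \<Psi> (?a (snd z), x) \<partial>\<mu>\<bar> \<le> B" .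
    qed
    then show ?thesis by (simp add: a_\<tau>)
  qed
  have "real m * (\<integral>z. \<Psi> (\<pi> (?a (snd z)), overlap (snd z) 1 (m + 1)) \<partial>joint) =
      (\<integral>z. (\<integral>x. \<Psi> (\<pi> (?a (snd z)), x) \<partial>\<mu>) \<partial>joint)
      + (\<Sum>l = 2..m. \<integral>z. \<Psi> (\<pi> (?a (snd z)), overlap (snd z) 1 l) \<partial>joint)"
    using ghirlanda_guerra_array_1[OF m, of "\<lambda>p. \<Psi> (\<pi> (fst p), snd p)" B] by (simp add: bound \<pi>_space)
  also have "(\<Sum>l = 2..m. \<integral>z. \<Psi> (\<pi> (?a (snd z)), overlap (snd z) 1 l) \<partial>joint)
      = (\<Sum>l\<in>{1..m} - {j}. \<integral>z. \<Psi> (\<pi> (?a (snd z)), overlap (snd z) 1 (\<tau> l)) \<partial>joint)"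
  proof (rule sum.reindex_bij_witness[where i = \<tau> and j = \<tau>])
    fix l assume "l \<in> {2..m}"
    then have "\<tau> l \<in> {1..m}" "\<tau> l \<noteq> j" using \<tau>_m[of l] \<tau>_\<tau>[of l] \<tau>1 by auto
    then show "\<tau> l \<in> {1..m} - {j}" by simp
  next
    fix l assume "l \<in> {1..m} - {j}"
    then have "\<tau> l \<in> {1..m}" "\<tau> l \<noteq> 1" using \<tau>_m[of l] \<tau>_\<tau>[of l] \<tau>1 by auto
    then show "\<tau> l \<in> {2..m}" by simp
  qed (simp_all add: \<tau>_\<tau>)
  also have "\<dots> = (\<Sum>l\<in>{1..m} - {j}. \<integral>z. \<Psi> (?a (snd z), overlap (snd z) j l) \<partial>joint)"
    by (intro sum.cong refl swap) auto
  also note swap_\<mu>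
  finally show ?thesis
    using swap[of "m + 1"] \<tau>1 by simp
qed

end

section \<open>Functions of the overlaps of finitely many replicas\<close>

context random_measure
begin

text \<open>Measurable functions of the overlaps of the first \<open>m\<close> replicas, self-overlaps included.\<close>

definition array_function :: "nat \<Rightarrow> ((nat \<Rightarrow> 'h) \<Rightarrow> real) \<Rightarrow> bool" where
  "array_function m h \<longleftrightarrow>
     (\<exists>u\<in>borel_measurable (array_space (square m)). h = (\<lambda>\<sigma>. u (overlap_array (square m) \<sigma>)))"

lemma array_functionI:
  "u \<in> borel_measurable (array_space (square m)) \<Longrightarrow> (\<And>\<sigma>. h \<sigma> = u (overlap_array (square m) \<sigma>)) \<Longrightarrow> array_function m h"
  unfolding array_function_def by blast

lemma array_functionE:
  assumes "array_function m h"
  obtains u where "u \<in> borel_measurable (array_space (square m))" "h = (\<lambda>\<sigma>. u (overlap_array (square m) \<sigma>))"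
  using assms unfolding array_function_def by (elim bexE)

lemma array_function_measurable:
  assumes "array_function m h"
  shows "h \<in> borel_measurable replica_space"
proof -
  obtain u where u: "u \<in> borel_measurable (array_space (square m))" "h = (\<lambda>\<sigma>. u (overlap_array (square m) \<sigma>))"
    using assms by (rule array_functionE)
  then show ?thesis
    using measurable_compose[OF square_array_measurable u(1)] by simp
qed

lemma array_function_mono:
  assumes "array_function m h" "m \<le> m'"
  shows "array_function m' h"
proof -
  have sub: "square m \<subseteq> square m'" using assms(2) by auto
  obtain u where u: "u \<in> borel_measurable (array_space (square m))" "h = (\<lambda>\<sigma>. u (overlap_array (square m) \<sigma>))"
    using assms(1) by (rule array_functionE)
  have "restrict (overlap_array (square m') \<sigma>) (square m) = overlap_array (square m) \<sigma>" for \<sigma> :: "nat \<Rightarrow> 'h"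
    using assms(2) by (auto simp: overlap_array_def fun_eq_iff)
  then show ?thesis
    by (intro array_functionI[OF measurable_compose[OF measurable_restrict_subset[OF sub] u(1)]]) (simp add: u(2))
qed

lemma array_function_diff:
  assumes "array_function m g" "array_function m h"
  shows "array_function m (\<lambda>\<sigma>. g \<sigma> - h \<sigma>)"
proof -
  obtain u where u: "u \<in> borel_measurable (array_space (square m))" "g = (\<lambda>\<sigma>. u (overlap_array (square m) \<sigma>))"
    using assms(1) by (rule array_functionE)
  obtain v where v: "v \<in> borel_measurable (array_space (square m))" "h = (\<lambda>\<sigma>. v (overlap_array (square m) \<sigma>))"
    using assms(2) by (rule array_functionE)
  show ?thesis
    using u v by (intro array_functionI[of "\<lambda>a. u a - v a"]) auto
qed

lemma array_function_mult:
  assumes "array_function m g" "array_function m h"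
  shows "array_function m (\<lambda>\<sigma>. g \<sigma> * h \<sigma>)"
proof -
  obtain u where u: "u \<in> borel_measurable (array_space (square m))" "g = (\<lambda>\<sigma>. u (overlap_array (square m) \<sigma>))"
    using assms(1) by (rule array_functionE)
  obtain v where v: "v \<in> borel_measurable (array_space (square m))" "h = (\<lambda>\<sigma>. v (overlap_array (square m) \<sigma>))"
    using assms(2) by (rule array_functionE)
  show ?thesis
    using u v by (intro array_functionI[of "\<lambda>a. u a * v a"]) auto
qed

lemma array_function_const: "array_function m (\<lambda>_. c)"
  by (rule array_functionI[of "\<lambda>_. c"]) auto

lemma array_function_sum:
  assumes "\<And>i. i \<in> I \<Longrightarrow> array_function m (h i)"
  shows "array_function m (\<lambda>\<sigma>. \<Sum>i\<in>I. h i \<sigma>)"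
proof -
  have "\<exists>u. \<forall>i\<in>I. u i \<in> borel_measurable (array_space (square m)) \<and> (\<forall>\<sigma>. h i \<sigma> = u i (overlap_array (square m) \<sigma>))"
    using assms unfolding array_function_def by (intro bchoice) (metis (no_types, lifting))
  then obtain u where u: "\<And>i. i \<in> I \<Longrightarrow> u i \<in> borel_measurable (array_space (square m))"
      "\<And>i \<sigma>. i \<in> I \<Longrightarrow> h i \<sigma> = u i (overlap_array (square m) \<sigma>)"
    by blast
  show ?thesis
    by (rule array_functionI[of "\<lambda>a. \<Sum>i\<in>I. u i a"]) (auto intro!: borel_measurable_sum u(1) sum.cong u(2))
qed

end

section \<open>The interpolation and its derivatives\<close>

lemma has_real_derivative_exp_div_power:
  fixes Z :: "real \<Rightarrow> real"
  assumes Z: "(Z has_real_derivative Z') (at t)" "Z t \<noteq> 0"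
  shows "((\<lambda>t. c * exp (t * d) / Z t ^ m) has_real_derivative
    c * exp (t * d) * (d * Z t - real m * Z') / Z t ^ (m + 1)) (at t)"
proof (cases m)
  case 0
  then show ?thesis
    using Z by (auto intro!: derivative_eq_intros)
next
  case (Suc i)
  have pow: "((\<lambda>t. Z t ^ m) has_real_derivative real m * Z t ^ i * Z') (at t)"
    using DERIV_power[OF Z(1), of m] by (simp add: Suc mult_ac)
  have "((\<lambda>t. c * exp (t * d)) has_real_derivative c * (exp (t * d) * d)) (at t)"
    by (auto intro!: derivative_eq_intros)
  from DERIV_divide[OF this pow]
  have "((\<lambda>t. c * exp (t * d) / Z t ^ m) has_real_derivative
      ((c * (exp (t * d) * d)) * Z t ^ m - c * exp (t * d) * (real m * Z t ^ i * Z')) / (Z t ^ m * Z t ^ m)) (at t)"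
    using Z(2) by simp
  also have "((c * (exp (t * d) * d)) * Z t ^ m - c * exp (t * d) * (real m * Z t ^ i * Z')) / (Z t ^ m * Z t ^ m)
      = c * exp (t * d) * (d * Z t - real m * Z') / Z t ^ (m + 1)"
    using Z(2) by (simp add: Suc divide_simps) (simp add: algebra_simps power_add)
  finally show ?thesis .
qed

text \<open>The data of the theorem, with bounds \<open>L\<close> for the functions \<open>f\<^sub>j\<close> and \<open>C\<close> for \<open>\<Phi>\<close>.\<close>

locale interpolation = ghirlanda_guerra_measure M G
  for M :: "'w measure" and G :: "'w \<Rightarrow> 'h::{real_inner, polish_space} measure" +
  fixes n :: nat and f :: "nat \<Rightarrow> (nat \<times> nat \<Rightarrow> real) \<times> real \<Rightarrow> real" and \<Phi> :: "(nat \<times> nat \<Rightarrow> real) \<Rightarrow> real"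
    and L C :: real
  assumes n: "n \<ge> 1"
    and f_measurable: "\<And>j. j \<in> {1..n} \<Longrightarrow> f j \<in> borel_measurable (array_space (offdiag n) \<Otimes>\<^sub>M borel)"
    and f_bound: "\<And>j a x. j \<in> {1..n} \<Longrightarrow> a \<in> space (array_space (offdiag n)) \<Longrightarrow> \<bar>f j (a, x)\<bar> \<le> L"
    and L: "L > 0"
    and \<Phi>_measurable: "\<Phi> \<in> borel_measurable (array_space (offdiag n))"
    and \<Phi>_bound: "\<And>a. a \<in> space (array_space (offdiag n)) \<Longrightarrow> \<bar>\<Phi> a\<bar> \<le> C"
begin

lemma overlaps_space: "overlaps n \<sigma> \<in> space (array_space (offdiag n))"
  unfolding overlaps_def by (rule overlap_array_in_space)

lemma offdiag_subset_square: "m \<ge> n \<Longrightarrow> offdiag n \<subseteq> square m"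
  by (auto simp: offdiag_def)

lemma overlaps_eq_restrict: "m \<ge> n \<Longrightarrow> overlaps n \<sigma> = restrict (overlap_array (square m) \<sigma>) (offdiag n)"
  by (auto simp: overlaps_def overlap_array_def offdiag_def fun_eq_iff)

lemma restrict_offdiag_measurable:
  "m \<ge> n \<Longrightarrow> (\<lambda>a. restrict a (offdiag n)) \<in> array_space (square m) \<rightarrow>\<^sub>M array_space (offdiag n)"
  by (rule measurable_restrict_subset[OF offdiag_subset_square])

lemma overlaps_measurable: "overlaps n \<in> replica_space \<rightarrow>\<^sub>M array_space (offdiag n)"
  unfolding overlaps_def by (rule overlap_array_measurable) (auto simp: offdiag_def)

text \<open>The contribution of \<open>f\<^sub>j\<close> to the energy of the replica \<open>l\<close>. The self-overlap never enters: it
  is replaced by an independent overlap, which is averaged out.\<close>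

definition interaction :: "nat \<Rightarrow> nat \<Rightarrow> (nat \<Rightarrow> 'h) \<Rightarrow> real" where
  "interaction j l \<sigma> = (if j = l then \<integral>x. f j (overlaps n \<sigma>, x) \<partial>\<mu> else f j (overlaps n \<sigma>, overlap \<sigma> j l))"

text \<open>The energy of the replica \<open>l\<close>: this is \<open>F\<^sub>l\<close> at \<open>\<sigma>\<^sup>l\<close> if \<open>l \<le> n\<close>, and \<open>F\<close> at \<open>\<sigma>\<^sup>l\<close> if \<open>l > n\<close>.\<close>

definition energy :: "nat \<Rightarrow> (nat \<Rightarrow> 'h) \<Rightarrow> real" where
  "energy l \<sigma> = (\<Sum>j = 1..n. interaction j l \<sigma>)"

text \<open>The sum \<open>D\<^sub>m\<close> of the energies of the first \<open>m\<close> replicas.\<close>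

definition total_energy :: "nat \<Rightarrow> (nat \<Rightarrow> 'h) \<Rightarrow> real" where
  "total_energy m \<sigma> = (\<Sum>l = 1..m. energy l \<sigma>)"

text \<open>The function \<open>A\<^sub>k\<close> of the overlaps of \<open>n + k\<close> replicas that appears in the \<open>k\<close>-th derivative.\<close>

primrec coefficient :: "nat \<Rightarrow> (nat \<Rightarrow> 'h) \<Rightarrow> real" where
  "coefficient 0 \<sigma> = \<Phi> (overlaps n \<sigma>)"
| "coefficient (Suc k) \<sigma> =
     coefficient k \<sigma> * (total_energy (n + k) \<sigma> - real (n + k) * energy (n + k + 1) \<sigma>)"

text \<open>The normalisation \<open>Z(t)\<close>, whose \<open>n\<close>-th power at \<open>t = 1\<close> is the denominator in
  the theorem, and its derivative in \<open>t\<close>, as \<open>partition_function_has_derivative\<close> shows.\<close>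

definition partition_function :: "real \<Rightarrow> 'w \<times> (nat \<Rightarrow> 'h) \<Rightarrow> real" where
  "partition_function t z = (\<integral>s. exp (t * F_total n f s (snd z)) \<partial>G (fst z))"

definition partition_function_deriv :: "real \<Rightarrow> 'w \<times> (nat \<Rightarrow> 'h) \<Rightarrow> real" where
  "partition_function_deriv t z = (\<integral>s. F_total n f s (snd z) * exp (t * F_total n f s (snd z)) \<partial>G (fst z))"

text \<open>The interpolation \<open>\<phi>\<^sub>0\<close> between the two sides of the theorem, and its derivatives \<open>\<phi>\<^sub>k\<close>.\<close>

definition tilted :: "nat \<Rightarrow> real \<Rightarrow> real" where
  "tilted k t = (\<integral>z. coefficient k (snd z) * exp (t * total_energy (n + k) (snd z))
      / partition_function t z ^ (n + k) \<partial>joint)"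

abbreviation K :: real where "K \<equiv> real n * L"

lemma K_pos: "K > 0"
  using n L by simp

lemma C_nonneg: "C \<ge> 0"
  by (rule order.trans[OF abs_ge_zero \<Phi>_bound[OF overlaps_space[of undefined]]])

lemma integral_\<mu>_bound:
  assumes j: "j \<in> {1..n}"
  shows "\<bar>\<integral>x. f j (overlaps n \<sigma>, x) \<partial>\<mu>\<bar> \<le> L"
proof -
  have "(\<lambda>x. f j (overlaps n \<sigma>, x)) \<in> borel_measurable borel"
    using measurable_compose[OF measurable_Pair1'[OF overlaps_space] f_measurable[OF j]] .
  then have m: "(\<lambda>x. f j (overlaps n \<sigma>, x)) \<in> borel_measurable \<mu>"
    by (simp cong: measurable_cong_sets)
  have int: "integrable \<mu> (\<lambda>x. f j (overlaps n \<sigma>, x))"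
    using m by (intro \<mu>.integrable_const_bound[where B = L] AE_I2) (auto intro!: f_bound[OF j] overlaps_space)
  have "\<bar>\<integral>x. f j (overlaps n \<sigma>, x) \<partial>\<mu>\<bar> \<le> (\<integral>x. \<bar>f j (overlaps n \<sigma>, x)\<bar> \<partial>\<mu>)"
    by (rule integral_abs_bound)
  also have "\<dots> \<le> L"
    using int by (intro \<mu>.integral_le_const) (auto intro!: f_bound[OF j] overlaps_space)
  finally show ?thesis .
qed

lemma energy_bound: "\<bar>energy l \<sigma>\<bar> \<le> K"
proof -
  have "\<bar>energy l \<sigma>\<bar> \<le> (\<Sum>j = 1..n. \<bar>interaction j l \<sigma>\<bar>)"
    unfolding energy_def by (rule sum_abs)
  also have "\<dots> \<le> (\<Sum>j = 1..n. L)"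
    by (intro sum_mono) (auto simp: interaction_def intro!: integral_\<mu>_bound f_bound overlaps_space)
  finally show ?thesis by simp
qed

lemma F_total_bound: "\<bar>F_total n f s \<sigma>\<bar> \<le> K"
proof -
  have "\<bar>F_total n f s \<sigma>\<bar> \<le> (\<Sum>j = 1..n. \<bar>f j (overlaps n \<sigma>, s \<bullet> \<sigma> j)\<bar>)"
    unfolding F_total_def by (rule sum_abs)
  also have "\<dots> \<le> (\<Sum>j = 1..n. L)"
    by (intro sum_mono f_bound overlaps_space)
  finally show ?thesis by simp
qed

lemma total_energy_bound: "\<bar>total_energy m \<sigma>\<bar> \<le> real m * K"
proof -
  have "\<bar>total_energy m \<sigma>\<bar> \<le> (\<Sum>l = 1..m. \<bar>energy l \<sigma>\<bar>)"
    unfolding total_energy_def by (rule sum_abs)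
  also have "\<dots> \<le> (\<Sum>l = 1..m. K)"
    by (intro sum_mono energy_bound)
  finally show ?thesis by simp
qed

lemma coefficient_bound: "\<bar>coefficient k \<sigma>\<bar> \<le> C * (2 * real n * K) ^ k * fact k"
proof (induction k)
  case 0
  then show ?case by (simp add: \<Phi>_bound overlaps_space)
next
  case (Suc k)
  have "\<bar>total_energy (n + k) \<sigma> - real (n + k) * energy (n + k + 1) \<sigma>\<bar>
      \<le> \<bar>total_energy (n + k) \<sigma>\<bar> + real (n + k) * \<bar>energy (n + k + 1) \<sigma>\<bar>"
    using abs_triangle_ineq4[of "total_energy (n + k) \<sigma>" "real (n + k) * energy (n + k + 1) \<sigma>"]
    by (simp add: abs_mult)
  also have "\<dots> \<le> real (n + k) * K + real (n + k) * K"
    by (intro add_mono total_energy_bound mult_left_mono energy_bound) auto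
  also have "\<dots> = 2 * real (n + k) * K" by simp
  \<comment> \<open>As \<open>n \<ge> 1\<close>, the factor \<open>n + k\<close> is at most \<open>n (k + 1)\<close>, which makes the product a factorial.\<close>
  also have "real (n + k) \<le> real (n * Suc k)"
    using n by (subst of_nat_le_iff) simp
  then have "2 * real (n + k) * K \<le> 2 * real (n * Suc k) * K"
    using K_pos by (intro mult_right_mono mult_left_mono) auto
  finally have *: "\<bar>total_energy (n + k) \<sigma> - real (n + k) * energy (n + k + 1) \<sigma>\<bar> \<le> 2 * real (n * Suc k) * K" .
  have "\<bar>coefficient (Suc k) \<sigma>\<bar> \<le> (C * (2 * real n * K) ^ k * fact k) * (2 * real (n * Suc k) * K)"
    unfolding coefficient.simps abs_mult using C_nonneg K_pos by (intro mult_mono Suc *) auto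
  also have "\<dots> = C * (2 * real n * K) ^ Suc k * fact (Suc k)"
    by (simp add: algebra_simps)
  finally show ?case .
qed

lemma total_energy_Suc: "total_energy (m + 1) \<sigma> = total_energy m \<sigma> + energy (m + 1) \<sigma>"
  by (simp add: total_energy_def flip: Suc_eq_plus1)

lemma total_energy_n: "total_energy n \<sigma> = (\<Sum>l = 1..n. F_part \<mu> n f l (\<sigma> l) \<sigma>)"
  unfolding total_energy_def
proof (rule sum.cong[OF refl])
  fix l assume l: "l \<in> {1..n}"
  have "energy l \<sigma> = (\<integral>x. f l (overlaps n \<sigma>, x) \<partial>\<mu>) + (\<Sum>j\<in>{1..n} - {l}. f j (overlaps n \<sigma>, \<sigma> l \<bullet> \<sigma> j))"
    unfolding energy_def using l
    by (subst sum.remove[of _ l]) (auto simp: interaction_def overlap_def inner_commute intro!: sum.cong)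
  moreover have "F_total n f (\<sigma> l) \<sigma> = f l (overlaps n \<sigma>, \<sigma> l \<bullet> \<sigma> l) + (\<Sum>j\<in>{1..n} - {l}. f j (overlaps n \<sigma>, \<sigma> l \<bullet> \<sigma> j))"
    unfolding F_total_def using l by (subst sum.remove[of _ l]) auto
  ultimately show "energy l \<sigma> = F_part \<mu> n f l (\<sigma> l) \<sigma>"
    by (simp add: F_part_def)
qed

lemma F_total_replica: "l > n \<Longrightarrow> F_total n f (\<sigma> l) \<sigma> = energy l \<sigma>"
  unfolding F_total_def energy_def
  by (intro sum.cong) (auto simp: interaction_def overlap_def inner_commute)

text \<open>None of the quantities that involve \<open>m \<ge> n\<close> replicas depends on a replica \<open>k > m\<close>.\<close>

lemma overlaps_upd: "k > n \<Longrightarrow> overlaps n (\<sigma>(k := s)) = overlaps n \<sigma>"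
  by (auto simp: overlaps_def overlap_array_def overlap_def offdiag_def fun_eq_iff)

lemma energy_upd: "k > n \<Longrightarrow> l < k \<Longrightarrow> energy l (\<sigma>(k := s)) = energy l \<sigma>"
  unfolding energy_def
  by (intro sum.cong) (auto simp: interaction_def overlap_def overlaps_upd)

lemma total_energy_upd: "k > n \<Longrightarrow> m < k \<Longrightarrow> total_energy m (\<sigma>(k := s)) = total_energy m \<sigma>"
  unfolding total_energy_def by (intro sum.cong) (auto simp: energy_upd)

lemma coefficient_upd: "k > n + i \<Longrightarrow> coefficient i (\<sigma>(k := s)) = coefficient i \<sigma>"
  by (induction i) (auto simp: overlaps_upd total_energy_upd energy_upd)

lemma F_total_upd: "k > n \<Longrightarrow> F_total n f s' (\<sigma>(k := s)) = F_total n f s' \<sigma>"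
  unfolding F_total_def by (intro sum.cong) (auto simp: overlaps_upd)

lemma array_function_interaction:
  assumes "j \<in> {1..n}" "l \<in> {1..m}" "n \<le> m"
  shows "array_function m (interaction j l)"
proof (cases "j = l")
  case True
  have "f j \<in> borel_measurable (array_space (offdiag n) \<Otimes>\<^sub>M \<mu>)"
    using f_measurable[OF assms(1)] measurable_cong_sets[OF sets_pair_measure_cong[OF refl sets_overlap_law] refl] by blast
  then have "(\<lambda>a. \<integral>x. f j (a, x) \<partial>\<mu>) \<in> borel_measurable (array_space (offdiag n))"
    by measurable
  from measurable_compose[OF restrict_offdiag_measurable[OF assms(3)] this] show ?thesis
    by (rule array_functionI) (simp add: interaction_def True overlaps_eq_restrict[OF assms(3)])
next
  case False
  have jl: "(j, l) \<in> square m" using assms by auto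
  have "(\<lambda>a. (restrict a (offdiag n), a (j, l))) \<in> array_space (square m) \<rightarrow>\<^sub>M array_space (offdiag n) \<Otimes>\<^sub>M borel"
    by (intro measurable_Pair restrict_offdiag_measurable assms measurable_component_singleton jl)
  from measurable_compose[OF this f_measurable[OF assms(1)]] show ?thesis
    by (rule array_functionI) (use jl in \<open>simp add: interaction_def False overlaps_eq_restrict[OF assms(3)] overlap_array_def\<close>)
qed

lemma array_function_energy: "l \<in> {1..m} \<Longrightarrow> n \<le> m \<Longrightarrow> array_function m (energy l)"
  unfolding energy_def[abs_def] by (intro array_function_sum array_function_interaction) auto

lemma array_function_total_energy: "n \<le> m \<Longrightarrow> array_function m (total_energy m)"
  unfolding total_energy_def[abs_def] by (intro array_function_sum array_function_energy) auto

lemma array_function_coefficient: "array_function (n + k) (coefficient k)"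
proof (induction k)
  case 0
  show ?case
    by (rule array_functionI[OF measurable_compose[OF restrict_offdiag_measurable \<Phi>_measurable]])
      (auto simp flip: overlaps_eq_restrict)
next
  case (Suc k)
  have "array_function (n + Suc k) (\<lambda>\<sigma>. coefficient k \<sigma> * (total_energy (n + k) \<sigma> - real (n + k) * energy (n + k + 1) \<sigma>))"
    by (intro array_function_mult array_function_diff array_function_const array_function_energy
        array_function_mono[OF Suc] array_function_mono[OF array_function_total_energy]) auto
  then show ?case by simp
qed

lemma coefficient_measurable[measurable]: "coefficient k \<in> borel_measurable replica_space"
  and total_energy_measurable: "n \<le> m \<Longrightarrow> total_energy m \<in> borel_measurable replica_space"
  using array_function_measurable array_function_coefficient array_function_total_energy by blast+

lemma total_energy_measurable'[measurable]: "total_energy (n + k) \<in> borel_measurable replica_space"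
  by (simp add: total_energy_measurable)

lemma F_total_measurable[measurable]:
  "(\<lambda>p. F_total n f (snd p) (snd (fst p))) \<in> borel_measurable ((M \<Otimes>\<^sub>M replica_space) \<Otimes>\<^sub>M borel)"
  unfolding F_total_def
proof (intro borel_measurable_sum)
  fix j assume j: "j \<in> {1..n}"
  note [measurable] = component_measurable[of j] overlaps_measurable f_measurable[OF j]
  have [simp]: "1 \<le> j" using j by simp
  show "(\<lambda>p. f j (overlaps n (snd (fst p)), snd p \<bullet> snd (fst p) j)) \<in> borel_measurable ((M \<Otimes>\<^sub>M replica_space) \<Otimes>\<^sub>M borel)"
    by measurable
qed

lemma F_total_measurable_borel:
  assumes "z \<in> space (M \<Otimes>\<^sub>M replica_space)"
  shows "(\<lambda>s. F_total n f s (snd z)) \<in> borel_measurable borel"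
  using measurable_compose[OF measurable_Pair1'[OF assms] F_total_measurable] by simp

lemma exp_F_total_bounds:
  "exp (- (\<bar>t\<bar> * K)) \<le> exp (t * F_total n f s \<sigma>)" "exp (t * F_total n f s \<sigma>) \<le> exp (\<bar>t\<bar> * K)"
proof -
  have "\<bar>t * F_total n f s \<sigma>\<bar> \<le> \<bar>t\<bar> * K"
    unfolding abs_mult by (intro mult_left_mono F_total_bound) auto
  then show "exp (- (\<bar>t\<bar> * K)) \<le> exp (t * F_total n f s \<sigma>)" "exp (t * F_total n f s \<sigma>) \<le> exp (\<bar>t\<bar> * K)"
    by auto
qed

lemma partition_function_measurable[measurable]:
  "partition_function t \<in> borel_measurable (M \<Otimes>\<^sub>M replica_space)"
  unfolding partition_function_def
  using integral_G_measurable[of "\<lambda>p. exp (t * F_total n f (snd p) (snd (fst p)))"] by simp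

lemma partition_function_deriv_measurable[measurable]:
  "partition_function_deriv t \<in> borel_measurable (M \<Otimes>\<^sub>M replica_space)"
  unfolding partition_function_deriv_def
  using integral_G_measurable[of "\<lambda>p. F_total n f (snd p) (snd (fst p)) * exp (t * F_total n f (snd p) (snd (fst p)))"] by simp

context
  fixes z
  assumes z: "z \<in> space (M \<Otimes>\<^sub>M replica_space)"
begin

lemma fst_z: "fst z \<in> space M"
  using z by (auto simp: space_pair_measure)

lemma integrable_exp_F_total:
  "integrable (G (fst z)) (\<lambda>s. exp (t * F_total n f s (snd z)))"
  and partition_function_le: "\<bar>partition_function t z\<bar> \<le> exp (\<bar>t\<bar> * K)"
proof -
  have meas: "(\<lambda>s. exp (t * F_total n f s (snd z))) \<in> borel_measurable borel"
    using F_total_measurable_borel[OF z] by measurable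
  have bound: "\<bar>exp (t * F_total n f s (snd z))\<bar> \<le> exp (\<bar>t\<bar> * K)" for s
    using exp_F_total_bounds(2) by simp
  show "integrable (G (fst z)) (\<lambda>s. exp (t * F_total n f s (snd z)))"
    by (rule integral_G_bound(1)[OF fst_z meas bound])
  show "\<bar>partition_function t z\<bar> \<le> exp (\<bar>t\<bar> * K)"
    unfolding partition_function_def by (rule integral_G_bound(2)[OF fst_z meas bound])
qed

lemma partition_function_ge: "exp (- (\<bar>t\<bar> * K)) \<le> partition_function t z"
  unfolding partition_function_def
  by (intro prob_space.integral_ge_const[OF prob_space_G[OF fst_z]] integrable_exp_F_total AE_I2 exp_F_total_bounds)

lemma partition_function_pos: "partition_function t z > 0"
  using partition_function_ge[of t] by (meson exp_gt_zero less_le_trans)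

lemma partition_function_0: "partition_function 0 z = 1"
  using prob_space.prob_space[OF prob_space_G[OF fst_z]] by (simp add: partition_function_def)

lemma inverse_partition_function_power_le: "1 / partition_function t z ^ m \<le> exp (\<bar>t\<bar> * K) ^ m"
proof -
  have "1 / partition_function t z \<le> 1 / exp (- (\<bar>t\<bar> * K))"
    using partition_function_ge partition_function_pos by (intro divide_left_mono) auto
  then have "(1 / partition_function t z) ^ m \<le> (1 / exp (- (\<bar>t\<bar> * K))) ^ m"
    using partition_function_pos[of t] by (intro power_mono) auto
  then show ?thesis by (simp add: power_one_over exp_minus inverse_eq_divide)
qed

lemma integrable_F_total_exp:
  "integrable (G (fst z)) (\<lambda>s. F_total n f s (snd z) * exp (t * F_total n f s (snd z)))"
  and partition_function_deriv_le: "\<bar>partition_function_deriv t z\<bar> \<le> K * exp (\<bar>t\<bar> * K)"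
proof -
  have meas: "(\<lambda>s. F_total n f s (snd z) * exp (t * F_total n f s (snd z))) \<in> borel_measurable borel"
    using F_total_measurable_borel[OF z] by measurable
  have bound: "\<bar>F_total n f s (snd z) * exp (t * F_total n f s (snd z))\<bar> \<le> K * exp (\<bar>t\<bar> * K)" for s
    unfolding abs_mult using K_pos by (intro mult_mono F_total_bound) (auto simp: exp_F_total_bounds simp del: exp_le_cancel_iff)
  show "integrable (G (fst z)) (\<lambda>s. F_total n f s (snd z) * exp (t * F_total n f s (snd z)))"
    by (rule integral_G_bound(1)[OF fst_z meas bound])
  show "\<bar>partition_function_deriv t z\<bar> \<le> K * exp (\<bar>t\<bar> * K)"
    unfolding partition_function_deriv_def by (rule integral_G_bound(2)[OF fst_z meas bound])
qed

lemma partition_function_has_derivative: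
  "((\<lambda>t. partition_function t z) has_real_derivative partition_function_deriv t z) (at t)"
  unfolding partition_function_def partition_function_deriv_def
proof (rule has_real_derivative_integral[where a = "t - 1" and b = "t + 1" and B = "K * exp ((\<bar>t\<bar> + 1) * K)"])
  show "finite_measure (G (fst z))"
    using prob_space_G[OF fst_z] by (rule prob_space.finite_measure)
  show "((\<lambda>t. exp (t * F_total n f s (snd z))) has_real_derivative F_total n f s (snd z) * exp (r * F_total n f s (snd z))) (at r)" for s r
    by (auto intro!: derivative_eq_intros)
  show "\<bar>F_total n f s (snd z) * exp (r * F_total n f s (snd z))\<bar> \<le> K * exp ((\<bar>t\<bar> + 1) * K)"
    if "r \<in> {t - 1<..<t + 1}" for s r
  proof -
    have "exp (\<bar>r\<bar> * K) \<le> exp ((\<bar>t\<bar> + 1) * K)"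
      using that K_pos by (auto intro!: mult_right_mono)
    then have "exp (r * F_total n f s (snd z)) \<le> exp ((\<bar>t\<bar> + 1) * K)"
      using exp_F_total_bounds(2) by (rule order.trans[rotated])
    then show ?thesis
      unfolding abs_mult using K_pos by (intro mult_mono F_total_bound) (auto simp del: exp_le_cancel_iff)
  qed
qed (use integrable_exp_F_total integrable_F_total_exp in auto)

end

lemma tilted_integrand_bound:
  assumes z: "z \<in> space (M \<Otimes>\<^sub>M replica_space)" and r: "\<bar>t\<bar> \<le> r"
  shows "\<bar>coefficient k (snd z) * exp (t * total_energy m (snd z)) / partition_function t z ^ i\<bar>
    \<le> C * (2 * real n * K) ^ k * fact k * exp (r * K) ^ m * exp (r * K) ^ i"
proof -
  have "\<bar>t * total_energy m (snd z)\<bar> \<le> r * (real m * K)"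
    unfolding abs_mult using r by (intro mult_mono total_energy_bound) auto
  then have "exp (t * total_energy m (snd z)) \<le> exp (r * (real m * K))"
    by auto
  also have "\<dots> = exp (r * K) ^ m"
    by (simp add: mult_ac flip: exp_of_nat_mult)
  finally have e: "exp (t * total_energy m (snd z)) \<le> exp (r * K) ^ m" .
  have "exp (\<bar>t\<bar> * K) \<le> exp (r * K)"
    using r K_pos by (auto intro!: mult_right_mono)
  then have "exp (\<bar>t\<bar> * K) ^ i \<le> exp (r * K) ^ i"
    by (intro power_mono) auto
  then have Z: "1 / partition_function t z ^ i \<le> exp (r * K) ^ i"
    using inverse_partition_function_power_le[OF z] by (rule order.trans[rotated])
  have "\<bar>coefficient k (snd z) * exp (t * total_energy m (snd z)) / partition_function t z ^ i\<bar>
      = \<bar>coefficient k (snd z)\<bar> * exp (t * total_energy m (snd z)) * (1 / partition_function t z ^ i)"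
    using partition_function_pos[OF z, of t] by (simp add: abs_mult)
  also have "\<dots> \<le> C * (2 * real n * K) ^ k * fact k * exp (r * K) ^ m * exp (r * K) ^ i"
    using C_nonneg K_pos partition_function_pos[OF z, of t]
    by (intro mult_mono coefficient_bound e Z) (auto simp: less_imp_le)
  finally show ?thesis .
qed

lemma tilted_bound:
  assumes "0 \<le> t" "t \<le> 1"
  shows "\<bar>tilted k t\<bar> \<le> (C * exp K ^ (2 * n)) * (2 * real n * K * exp K ^ 2) ^ k * fact k"
proof -
  let ?h = "\<lambda>z. coefficient k (snd z) * exp (t * total_energy (n + k) (snd z)) / partition_function t z ^ (n + k)"
  let ?B = "C * (2 * real n * K) ^ k * fact k * exp (1 * K) ^ (n + k) * exp (1 * K) ^ (n + k)"
  have b: "\<bar>?h z\<bar> \<le> ?B" if "z \<in> space (M \<Otimes>\<^sub>M replica_space)" for z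
    using assms that by (intro tilted_integrand_bound) auto
  have meas: "?h \<in> borel_measurable joint" by measurable
  have int: "integrable joint ?h"
    by (rule joint.integrable_const_bound[OF AE_I2 meas]) (use b in \<open>simp only: real_norm_def space_joint\<close>)
  have "\<bar>tilted k t\<bar> \<le> (\<integral>z. \<bar>?h z\<bar> \<partial>joint)"
    unfolding tilted_def by (rule integral_abs_bound)
  also have "\<dots> \<le> ?B"
    by (intro joint.integral_le_const integrable_abs int AE_I2) (use b in \<open>simp only: space_joint\<close>)
  also have "?B = (C * exp K ^ (2 * n)) * (2 * real n * K * exp K ^ 2) ^ k * fact k"
  proof -
    have e: "e ^ (n + k) * e ^ (n + k) = e ^ (2 * n) * (e ^ 2) ^ k" for e :: real
      unfolding mult_2 power2_eq_square power_add power_mult_distrib by (simp only: mult_ac)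
    have "?B = C * (2 * real n * K) ^ k * fact k * (exp K ^ (n + k) * exp K ^ (n + k))"
      by (simp only: mult_1_left mult.assoc)
    also have "\<dots> = (C * exp K ^ (2 * n)) * (2 * real n * K * exp K ^ 2) ^ k * fact k"
      unfolding e by (simp only: power_mult_distrib mult_ac)
    finally show ?thesis .
  qed
  finally show ?thesis .
qed

lemma tilted_has_derivative: "(tilted k has_real_derivative tilted (Suc k) t) (at t)"
proof -
  let ?m = "n + k"
  let ?h = "\<lambda>z t. coefficient k (snd z) * exp (t * total_energy ?m (snd z)) / partition_function t z ^ ?m"
  let ?h' = "\<lambda>z t. coefficient k (snd z) * exp (t * total_energy ?m (snd z))
      * (total_energy ?m (snd z) * partition_function t z - real ?m * partition_function_deriv t z)
      / partition_function t z ^ (?m + 1)"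
  define r where "r = \<bar>t\<bar> + 1"
  define B where "B = (C * (2 * real n * K) ^ k * fact k * exp (r * K) ^ ?m * exp (r * K) ^ (?m + 1))
      * (real ?m * K * exp (r * K) + real ?m * (K * exp (r * K)))"
  have r: "\<bar>s\<bar> \<le> r" if "s \<in> {t - 1<..<t + 1}" for s
    using that by (auto simp: r_def)
  have "((\<lambda>t. \<integral>z. ?h z t \<partial>joint) has_real_derivative (\<integral>z. ?h' z t \<partial>joint)) (at t)"
  proof (rule has_real_derivative_integral[where a = "t - 1" and b = "t + 1" and B = B])
    show "finite_measure joint" by (rule joint.finite_measure_axioms)
    show "t \<in> {t - 1<..<t + 1}" by simp
    show "(?h z has_real_derivative ?h' z s) (at s)" if "z \<in> space joint" for z s
      using that partition_function_pos[of z s]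
      by (intro has_real_derivative_exp_div_power partition_function_has_derivative) auto
    show "\<bar>?h' z s\<bar> \<le> B" if z: "z \<in> space joint" and s: "s \<in> {t - 1<..<t + 1}" for z s
    proof -
      have z': "z \<in> space (M \<Otimes>\<^sub>M replica_space)" using z by simp
      have "exp (\<bar>s\<bar> * K) \<le> exp (r * K)"
        using r[OF s] K_pos by (auto intro!: mult_right_mono)
      then have "\<bar>partition_function s z\<bar> \<le> exp (r * K)" "\<bar>partition_function_deriv s z\<bar> \<le> K * exp (r * K)"
        using order.trans[OF partition_function_le[OF z']]
          order.trans[OF partition_function_deriv_le[OF z'] mult_left_mono[OF _ less_imp_le[OF K_pos]]]
        by blast+
      then have "\<bar>total_energy ?m (snd z) * partition_function s z\<bar> + \<bar>real ?m * partition_function_deriv s z\<bar>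
          \<le> real ?m * K * exp (r * K) + real ?m * (K * exp (r * K))"
        unfolding abs_mult using K_pos by (intro add_mono mult_mono total_energy_bound) auto
      then have d: "\<bar>total_energy ?m (snd z) * partition_function s z - real ?m * partition_function_deriv s z\<bar>
          \<le> real ?m * K * exp (r * K) + real ?m * (K * exp (r * K))"
        using abs_triangle_ineq4 by (rule order.trans[rotated])
      have "\<bar>?h' z s\<bar> = \<bar>coefficient k (snd z) * exp (s * total_energy ?m (snd z)) / partition_function s z ^ (?m + 1)\<bar>
          * \<bar>total_energy ?m (snd z) * partition_function s z - real ?m * partition_function_deriv s z\<bar>"
        by (simp add: abs_mult)
      also have "\<dots> \<le> B"
        unfolding B_def using C_nonneg K_pos
        by (intro mult_mono tilted_integrand_bound[OF z' r[OF s]] d) auto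
      finally show ?thesis .
    qed
    show "integrable joint (\<lambda>z. ?h z s)" if "s \<in> {t - 1<..<t + 1}" for s
    proof -
      have meas: "(\<lambda>z. ?h z s) \<in> borel_measurable joint" by measurable
      show ?thesis
        by (rule joint.integrable_const_bound[OF AE_I2 meas])
          (use tilted_integrand_bound[OF _ r[OF that]] in \<open>simp only: real_norm_def space_joint\<close>)
    qed
    show "(\<lambda>z. ?h' z t) \<in> borel_measurable joint" by measurable
  qed
  also have "(\<integral>z. ?h' z t \<partial>joint) = tilted (Suc k) t"
  proof -
    \<comment> \<open>The integrand before \<open>s\<close> is averaged; a new replica \<open>n + k + 1\<close> is put in the place of \<open>s\<close>.\<close>
    define H where "H = (\<lambda>(z, s). coefficient k (snd z) * exp (t * total_energy ?m (snd z))
      / partition_function t z ^ (?m + 1)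
      * ((total_energy ?m (snd z) - real ?m * F_total n f s (snd z)) * exp (t * F_total n f s (snd z))))"
    have [measurable]: "H \<in> borel_measurable ((M \<Otimes>\<^sub>M replica_space) \<Otimes>\<^sub>M borel)"
      unfolding H_def case_prod_beta' by measurable
    have "\<bar>H (z, s)\<bar> \<le> B" if z: "z \<in> space (M \<Otimes>\<^sub>M replica_space)" for z s
    proof -
      have "\<bar>total_energy ?m (snd z) - real ?m * F_total n f s (snd z)\<bar>
          \<le> \<bar>total_energy ?m (snd z)\<bar> + \<bar>real ?m * F_total n f s (snd z)\<bar>"
        by (rule abs_triangle_ineq4)
      also have "\<dots> \<le> real ?m * K + real ?m * K"
        unfolding abs_mult by (intro add_mono mult_mono total_energy_bound F_total_bound) auto
      finally have 1: "\<bar>total_energy ?m (snd z) - real ?m * F_total n f s (snd z)\<bar> \<le> real ?m * K + real ?m * K" .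
      have "exp (\<bar>t\<bar> * K) \<le> exp (r * K)"
        using K_pos by (auto simp: r_def intro!: mult_right_mono)
      then have 2: "exp (t * F_total n f s (snd z)) \<le> exp (r * K)"
        using exp_F_total_bounds(2) by (rule order.trans[rotated])
      have "\<bar>(total_energy ?m (snd z) - real ?m * F_total n f s (snd z)) * exp (t * F_total n f s (snd z))\<bar>
          \<le> (real ?m * K + real ?m * K) * exp (r * K)"
        unfolding abs_mult abs_exp_cancel using L by (intro mult_mono 1 2) auto
      also have "\<dots> = real ?m * K * exp (r * K) + real ?m * (K * exp (r * K))"
        by (simp add: algebra_simps)
      finally have 3: "\<bar>(total_energy ?m (snd z) - real ?m * F_total n f s (snd z)) * exp (t * F_total n f s (snd z))\<bar>
          \<le> real ?m * K * exp (r * K) + real ?m * (K * exp (r * K))" .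
      have "\<bar>t\<bar> \<le> r" by (simp add: r_def)
      then show ?thesis
        unfolding H_def B_def prod.case abs_mult[of "_ / _"] using C_nonneg K_pos L
        by (intro mult_mono tilted_integrand_bound[OF z] 3) auto
    qed
    moreover have "H ((\<omega>, \<sigma>(?m + 1 := s)), s') = H ((\<omega>, \<sigma>), s')" for \<omega> \<sigma> s s'
      using n by (simp add: H_def partition_function_def coefficient_upd total_energy_upd F_total_upd)
    ultimately have "(\<integral>z. (\<integral>s. H (z, s) \<partial>G (fst z)) \<partial>joint) = (\<integral>z. H (z, snd z (?m + 1)) \<partial>joint)"
      by (intro integral_joint_fresh_replica[where B = B]) auto
    moreover have "(\<integral>s. H (z, s) \<partial>G (fst z)) = ?h' z t" if "z \<in> space joint" for z
    proof -
      have z: "z \<in> space (M \<Otimes>\<^sub>M replica_space)" using that by simp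
      have "(\<integral>s. H (z, s) \<partial>G (fst z)) = coefficient k (snd z) * exp (t * total_energy ?m (snd z))
        / partition_function t z ^ (?m + 1)
        * (\<integral>s. total_energy ?m (snd z) * exp (t * F_total n f s (snd z))
            - real ?m * (F_total n f s (snd z) * exp (t * F_total n f s (snd z))) \<partial>G (fst z))"
        by (simp add: H_def left_diff_distrib mult.assoc)
      also have "(\<integral>s. total_energy ?m (snd z) * exp (t * F_total n f s (snd z))
            - real ?m * (F_total n f s (snd z) * exp (t * F_total n f s (snd z))) \<partial>G (fst z))
        = total_energy ?m (snd z) * partition_function t z - real ?m * partition_function_deriv t z"
        unfolding partition_function_def partition_function_deriv_def
        using integrable_exp_F_total[OF z] integrable_F_total_exp[OF z]
        by (subst Bochner_Integration.integral_diff) auto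
      finally show ?thesis by simp
    qed
    moreover have "H (z, snd z (?m + 1)) = coefficient (Suc k) (snd z) * exp (t * total_energy (n + Suc k) (snd z))
        / partition_function t z ^ (n + Suc k)" for z
    proof -
      have "exp (t * total_energy (?m + 1) \<sigma>) = exp (t * total_energy ?m \<sigma>) * exp (t * energy (?m + 1) \<sigma>)" for \<sigma>
        by (simp only: total_energy_Suc distrib_left exp_add)
      moreover have "F_total n f (snd z (?m + 1)) (snd z) = energy (?m + 1) (snd z)"
        using n by (intro F_total_replica) auto
      moreover have "n + Suc k = ?m + 1" by simp
      ultimately show ?thesis
        by (simp only: H_def prod.case coefficient.simps times_divide_eq_left times_divide_eq_right mult_ac)
    qed
    ultimately show ?thesis
      unfolding tilted_def by (simp only: cong: Bochner_Integration.integral_cong)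
  qed
  finally have "((\<lambda>t. \<integral>z. ?h z t \<partial>joint) has_real_derivative tilted (Suc k) t) (at t)" .
  moreover have "tilted k = (\<lambda>t. \<integral>z. ?h z t \<partial>joint)"
    by (rule ext) (rule tilted_def)
  ultimately show ?thesis by (simp only:)
qed

lemma tilted_0: "tilted k 0 = (\<integral>z. coefficient k (snd z) \<partial>joint)"
  unfolding tilted_def by (rule Bochner_Integration.integral_cong) (auto simp: partition_function_0)

lemma interaction_bound: "j \<in> {1..n} \<Longrightarrow> \<bar>interaction j l \<sigma>\<bar> \<le> L"
  by (auto simp: interaction_def intro!: integral_\<mu>_bound f_bound overlaps_space)

lemma integrable_coefficient_times:
  assumes h: "h \<in> borel_measurable replica_space" "\<And>\<sigma>. \<bar>h \<sigma>\<bar> \<le> B"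
  shows "integrable joint (\<lambda>z. coefficient k (snd z) * h (snd z))"
proof -
  note [measurable] = h(1)
  have meas: "(\<lambda>z. coefficient k (snd z) * h (snd z)) \<in> borel_measurable joint" by measurable
  show ?thesis
  proof (rule joint.integrable_const_bound[OF AE_I2 meas])
    show "norm (coefficient k (snd z) * h (snd z)) \<le> (C * (2 * real n * K) ^ k * fact k) * B" for z
      unfolding real_norm_def abs_mult using C_nonneg K_pos
      by (intro mult_mono coefficient_bound h(2)) auto
  qed
qed

lemma tilted_Suc_0: "tilted (Suc k) 0 = 0"
proof -
  let ?m = "n + k"
  let ?E = "\<lambda>h :: (nat \<Rightarrow> 'h) \<Rightarrow> real. \<integral>z. coefficient k (snd z) * h (snd z) \<partial>joint"
  define B where "B = C * (2 * real n * K) ^ k * fact k"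
  have B: "B \<ge> 0" using C_nonneg K_pos by (simp add: B_def)
  obtain u where u[measurable]: "u \<in> borel_measurable (array_space (square ?m))"
    and coefficient_eq: "coefficient k = (\<lambda>\<sigma>. u (overlap_array (square ?m) \<sigma>))"
    using array_function_coefficient by (rule array_functionE)
  \<comment> \<open>\<open>u\<close> need not be bounded at arrays that are not arrays of overlaps, so it is truncated.\<close>
  define v where "v a = max (- B) (min B (u a))" for a
  have v[measurable]: "v \<in> borel_measurable (array_space (square ?m))"
    unfolding v_def[abs_def] by measurable
  have v_bound: "\<bar>v a\<bar> \<le> B" for a
    using B by (auto simp: v_def)
  have v_eq: "v (overlap_array (square ?m) \<sigma>) = coefficient k \<sigma>" for \<sigma>
    using coefficient_bound[of k \<sigma>] unfolding B_def[symmetric] by (auto simp: v_def coefficient_eq)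
  have interaction_meas: "interaction j l \<in> borel_measurable replica_space" if "j \<in> {1..n}" "l \<ge> 1" for j l
    using that by (intro array_function_measurable[of "max n l"] array_function_interaction) auto
  have gg: "real ?m * ?E (interaction j (?m + 1)) = (\<Sum>l = 1..?m. ?E (interaction j l))" if j: "j \<in> {1..n}" for j
  proof -
    let ?\<Psi> = "\<lambda>p. v (fst p) * f j (restrict (fst p) (offdiag n), snd p)"
    have restr: "(\<lambda>p. restrict (fst p) (offdiag n)) \<in> array_space (square ?m) \<Otimes>\<^sub>M borel \<rightarrow>\<^sub>M array_space (offdiag n)"
      by (rule measurable_compose[OF measurable_fst restrict_offdiag_measurable]) simp
    have \<Psi>_meas: "?\<Psi> \<in> borel_measurable (array_space (square ?m) \<Otimes>\<^sub>M borel)"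
      by (intro borel_measurable_times measurable_compose[OF measurable_fst v]
          measurable_compose[OF measurable_Pair[OF restr measurable_snd] f_measurable[OF j]])
    have \<Psi>_bound: "\<bar>?\<Psi> (a, x)\<bar> \<le> B * L" for a x
      unfolding abs_mult fst_conv using B
      by (intro mult_mono v_bound f_bound[OF j]) (auto simp: space_PiM)
    have "j \<in> {1..?m}" using j by auto
    from ghirlanda_guerra_array[OF this \<Psi>_meas \<Psi>_bound] have "real ?m * (\<integral>z. ?\<Psi> (overlap_array (square ?m) (snd z), overlap (snd z) j (?m + 1)) \<partial>joint) =
      (\<integral>z. (\<integral>x. ?\<Psi> (overlap_array (square ?m) (snd z), x) \<partial>\<mu>) \<partial>joint)
      + (\<Sum>l\<in>{1..?m} - {j}. \<integral>z. ?\<Psi> (overlap_array (square ?m) (snd z), overlap (snd z) j l) \<partial>joint)"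
      .
    then have "real ?m * (\<integral>z. coefficient k (snd z) * f j (overlaps n (snd z), overlap (snd z) j (?m + 1)) \<partial>joint) =
      (\<integral>z. coefficient k (snd z) * (\<integral>x. f j (overlaps n (snd z), x) \<partial>\<mu>) \<partial>joint)
      + (\<Sum>l\<in>{1..?m} - {j}. \<integral>z. coefficient k (snd z) * f j (overlaps n (snd z), overlap (snd z) j l) \<partial>joint)"
      by (simp only: fst_conv snd_conv v_eq overlaps_eq_restrict[OF le_add1, symmetric] integral_mult_right_zero)
    moreover have "(\<integral>z. coefficient k (snd z) * f j (overlaps n (snd z), overlap (snd z) j (?m + 1)) \<partial>joint) = ?E (interaction j (?m + 1))"
      using j by (simp add: interaction_def)
    moreover have "(\<integral>z. coefficient k (snd z) * (\<integral>x. f j (overlaps n (snd z), x) \<partial>\<mu>) \<partial>joint) = ?E (interaction j j)"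
      by (simp add: interaction_def)
    moreover have "(\<Sum>l\<in>{1..?m} - {j}. \<integral>z. coefficient k (snd z) * f j (overlaps n (snd z), overlap (snd z) j l) \<partial>joint)
        = (\<Sum>l\<in>{1..?m} - {j}. ?E (interaction j l))"
      by (intro sum.cong) (auto simp: interaction_def)
    moreover have "(\<Sum>l = 1..?m. ?E (interaction j l)) = ?E (interaction j j) + (\<Sum>l\<in>{1..?m} - {j}. ?E (interaction j l))"
      using j by (intro sum.remove) auto
    ultimately show ?thesis by simp
  qed
  have E_energy: "?E (energy l) = (\<Sum>j = 1..n. ?E (interaction j l))" if "l \<ge> 1" for l
    unfolding energy_def sum_distrib_left using that
    by (intro Bochner_Integration.integral_sum integrable_coefficient_times[where B = L] interaction_meas interaction_bound) auto
  have int_energy: "integrable joint (\<lambda>z. coefficient k (snd z) * energy l (snd z))" if "l \<ge> 1" for l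
    using that
    by (intro integrable_coefficient_times[where B = K] energy_bound array_function_measurable[of "max n l"] array_function_energy) auto
  have int_total: "integrable joint (\<lambda>z. coefficient k (snd z) * total_energy ?m (snd z))"
    by (intro integrable_coefficient_times[where B = "real ?m * K"] total_energy_bound) measurable
  have "tilted (Suc k) 0 = (\<integral>z. coefficient k (snd z) * total_energy ?m (snd z)
      - real ?m * (coefficient k (snd z) * energy (?m + 1) (snd z)) \<partial>joint)"
    unfolding tilted_0 coefficient.simps by (simp only: right_diff_distrib mult_ac)
  also have "\<dots> = ?E (total_energy ?m) - real ?m * ?E (energy (?m + 1))"
    using int_total int_energy[of "?m + 1"] by (subst Bochner_Integration.integral_diff) auto
  also have "?E (total_energy ?m) = (\<Sum>l = 1..?m. ?E (energy l))"
    unfolding total_energy_def sum_distrib_left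
    by (intro Bochner_Integration.integral_sum int_energy) auto
  also have "\<dots> = (\<Sum>l = 1..?m. \<Sum>j = 1..n. ?E (interaction j l))"
    by (intro sum.cong E_energy) auto
  also have "\<dots> = (\<Sum>j = 1..n. \<Sum>l = 1..?m. ?E (interaction j l))"
    by (rule sum.swap)
  also have "\<dots> = (\<Sum>j = 1..n. real ?m * ?E (interaction j (?m + 1)))"
    by (intro sum.cong gg[symmetric]) auto
  also have "\<dots> = real ?m * ?E (energy (?m + 1))"
    by (subst E_energy) (simp_all only: sum_distrib_left le_add2)
  finally show ?thesis by simp
qed

lemma tilted_0_1: "tilted 0 1 = tilted 0 0"
  by (rule constant_if_derivatives_vanish_at_0[OF tilted_has_derivative tilted_bound tilted_Suc_0])
    (use K_pos n in auto)

lemma stability: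
  "(\<integral>\<omega>. replica_average (G \<omega>) (\<lambda>\<sigma>. \<Phi> (overlaps n \<sigma>)) \<partial>M) =
    (\<integral>\<omega>. replica_average (G \<omega>)
       (\<lambda>\<sigma>. \<Phi> (overlaps n \<sigma>) * exp (\<Sum>l = 1..n. F_part \<mu> n f l (\<sigma> l) \<sigma>)
             / (\<integral>s. exp (F_total n f s \<sigma>) \<partial>G \<omega>) ^ n) \<partial>M)"
proof -
  let ?h = "\<lambda>z. coefficient 0 (snd z) * exp (1 * total_energy (n + 0) (snd z)) / partition_function 1 z ^ (n + 0)"
  have "(\<integral>\<omega>. replica_average (G \<omega>) (\<lambda>\<sigma>. \<Phi> (overlaps n \<sigma>)) \<partial>M) = tilted 0 0"
    unfolding tilted_0 coefficient.simps
    by (intro integral_replica_average[where B = C] \<Phi>_bound overlaps_space measurable_compose[OF overlaps_measurable \<Phi>_measurable])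
  also have "\<dots> = (\<integral>z. ?h z \<partial>joint)"
    unfolding tilted_def[symmetric] by (rule tilted_0_1[symmetric])
  also have "\<dots> = (\<integral>\<omega>. (\<integral>\<sigma>. ?h (\<omega>, \<sigma>) \<partial>replicas \<omega>) \<partial>M)"
  proof (rule integral_joint)
    show "?h \<in> borel_measurable (M \<Otimes>\<^sub>M replica_space)" by measurable
    show "\<bar>?h z\<bar> \<le> C * (2 * real n * K) ^ 0 * fact 0 * exp (1 * K) ^ (n + 0) * exp (1 * K) ^ (n + 0)"
      if "z \<in> space (M \<Otimes>\<^sub>M replica_space)" for z
      using that by (rule tilted_integrand_bound) simp
  qed
  also have "\<dots> = (\<integral>\<omega>. replica_average (G \<omega>)
       (\<lambda>\<sigma>. \<Phi> (overlaps n \<sigma>) * exp (\<Sum>l = 1..n. F_part \<mu> n f l (\<sigma> l) \<sigma>)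
             / (\<integral>s. exp (F_total n f s \<sigma>) \<partial>G \<omega>) ^ n) \<partial>M)"
    by (simp add: replica_average_eq partition_function_def total_energy_n)
  finally show ?thesis .
qed

end

section \<open>The stability property\<close>

theorem theorem1:
  fixes M :: "'w measure"
    and G :: "'w \<Rightarrow> 'h::{real_inner, polish_space} measure"
    and n :: nat
    and f :: "nat \<Rightarrow> (nat \<times> nat \<Rightarrow> real) \<times> real \<Rightarrow> real"
    and \<Phi> :: "(nat \<times> nat \<Rightarrow> real) \<Rightarrow> real"
  assumes "random_measure_on_unit_ball M G"
    and "ghirlanda_guerra M G"
    and "n \<ge> 1"
    and "\<And>l. l \<in> {1..n} \<Longrightarrow> bounded_measurable (array_space (offdiag n) \<Otimes>\<^sub>M borel) (f l)"
    and "bounded_measurable (array_space (offdiag n)) \<Phi>"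
  shows "(\<integral>\<omega>. replica_average (G \<omega>) (\<lambda>\<sigma>. \<Phi> (overlaps n \<sigma>)) \<partial>M) =
    (\<integral>\<omega>. replica_average (G \<omega>)
       (\<lambda>\<sigma>. \<Phi> (overlaps n \<sigma>) * exp (\<Sum>l = 1..n. F_part (overlap_law M G) n f l (\<sigma> l) \<sigma>)
             / (\<integral>s. exp (F_total n f s \<sigma>) \<partial>G \<omega>) ^ n) \<partial>M)"
proof -
  let ?S = "space (array_space (offdiag n) \<Otimes>\<^sub>M (borel :: real measure))"
  have "bounded (\<Union>l\<in>{1..n}. f l ` ?S)"
    using assms(4) by (intro bounded_UN) (auto simp: bounded_measurable_def)
  then obtain L where L: "L > 0" "\<And>y. y \<in> (\<Union>l\<in>{1..n}. f l ` ?S) \<Longrightarrow> \<bar>y\<bar> \<le> L"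
    unfolding bounded_pos real_norm_def by blast
  obtain C where C: "\<And>y. y \<in> \<Phi> ` space (array_space (offdiag n)) \<Longrightarrow> \<bar>y\<bar> \<le> C"
    using assms(5) unfolding bounded_measurable_def bounded_iff real_norm_def by blast
  have "\<bar>f j (a, x)\<bar> \<le> L" if "j \<in> {1..n}" "a \<in> space (array_space (offdiag n))" for j a x
    using that by (intro L(2) UN_I[of j] imageI) (auto simp: space_pair_measure)
  then interpret interpolation M G n f \<Phi> L C
    using assms L(1) C by unfold_locales (auto simp: bounded_measurable_def)
  show ?thesis by (rule stability)
qed

end
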